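(* Let $d,m\in\mathbb{N}$, $0\le m_2\le m$, and let $g_1,\ldots,g_m\in\mathcal{H}$ be strongly nonpolynomial functions with $1\prec g_1(t)\prec\cdots\prec g_m(t)\ll t^d$ such that $\operatorname{fracdeg}g_i=0$ if and only if $i\in\{1,\ldots,m_2\}$. Let $q\in\mathbb{N}$. Then there exist positive functions $H,L\in\mathcal{H}$ with fractional degrees in $(0,1)$ and integers $d_{g_1},\ldots,d_{g_m}\ge0$ such that for every $i\in\{1,\ldots,m\}$ the Taylor approximants $$g_{iN}(n)=\sum_{l=0}^{d_{g_i}}\frac{g_i^{(l)}(N)}{l!}n^l$$ satisfy $$\lim_{N\to\infty}|g_i^{(d_{g_i})}(N)|\cdot N^{d_{g_i}}=\infty\quad\text{and}\quad\lim_{N\to\infty}\max_{1\le n\le L(N)}|g_i(N+n)-g_{iN}(n)|=0,$$ and the following conditions hold: (i) if $i>m_2$ (i.e. $\operatorname{fracdeg}g_i>0$), then $d_{g_i}\ge q$; otherwise $d_{g_i}=0$; (ii) for all $i,j\in\{1,\ldots,m\}$, $d_{g_i}=d_{g_j}$ if and only if $\operatorname{fracdeg}g_i=\operatorname{fracdeg}g_j$; (iii) for all $i,j\in\{m_2+1,\ldots,m\}$, $$\big|g_i^{(d_{g_i})}(N)\big|^{-\frac{1}{d_{g_i}}}\lll H(N)\lll L(N)\lll\big|g_j^{(d_{g_j}+1)}(N)\big|^{-\frac{1}{d_{g_j}+1}};$$ (iv) for all $i\in\{m_2+1,\ldots,m\}$, $$\operatorname{fracdeg}\big|g_i^{(d_{g_i})}(N)\big|^{-\frac{1}{d_{g_i}}}\le\operatorname{fracdeg}\big|g_m^{(d_{g_m})}(N)\big|^{-\frac{1}{d_{g_m}}},$$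 with equality if and only if $\operatorname{fracdeg}g_i=\operatorname{fracdeg}g_m$; (v) for all distinct $i,j\in\{1,\ldots,m\}$, $$g_i^{(d_{g_i})}(N)H(N)^{d_{g_i}}\not\asymp g_j^{(d_{g_j})}(N)H(N)^{d_{g_j}}.$$ Moreover, $H$ takes the form $$H(N)=\begin{cases}|g_m^{(d_{g_m})}(N)|^{-1/d_{g_m}}N^\eta,&\text{if } d_{g_m}>0,\\ N^\eta,&\text{if } d_{g_m}=0,\end{cases}$$ where $\eta$ can be any number from an interval $(0,\eta_0)$ for some $\eta_0>0$ depending only on the numbers $\operatorname{fracdeg}g_i,d_{g_i}$, and $L$ can be any such function satisfying $L\succ H$ and (iii).
   Context: Hardy functions: let $B$ be the ring of germs at $+\infty$ of real-valued functions defined on half-lines $(t_0,\infty)$. A Hardy field is a subfield of $B$ closed under differentiation. Fix a Hardy field $\mathcal{H}_0$ closed under composition and compositional inversion, i.e. if $a_1,a_2\in\mathcal{H}_0$ and $\lim_{t\to\infty}a_2(t)=\infty$, then $a_1\circ a_2,\ a_2^{-1}\in\mathcal{H}_0$ (for example the Hardy field of Pfaffian functions, which contains the logarithmico-exponential functions). Let $\mathcal{H}=\{a\in\mathcal{H}_0:\ a(t)\ll t^c \text{ for some } c>0\}$. $a\in\mathcal{H}$ is strongly nonpolynomial if $t^{e}\prec a(t)\prec t^{e+1}$ for some integer $e\ge0$. Fractional degree: $\operatorname{fracdeg}a=\lim_{t\to\infty}\frac{ta'(t)}{a(t)}$ (this limit exists and is a real number for $a\in\mathcal{H}$). Asymptotics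 (as $t\to\infty$): $a\ll b$ means $|a(t)|\le C|b(t)|$ for some $C>0$ and all large $t$; $a\asymp b$ means $a\ll b$ and $b\ll a$; $a\prec b$ (equivalently $b\succ a$) means $a(t)/b(t)\to0$; $a\lll b$ means there is $\delta>0$ with $|a(t)|t^\delta\prec|b(t)|$ (equivalently $\operatorname{fracdeg}a<\operatorname{fracdeg}b$). $g^{(l)}$ is the $l$-th derivative.
   Formalization: For arbitrary η in (0,η_0), membership of H in the Hardy field is claimed only if t^η lies in H_0 (it fails for irrational η when H_0 is the real algebraic germs, g_1=t^{1/2}); all other properties hold for every η, and some H, L in the field always exist. *)

theory Defs
  imports "HOL-Analysis.Analysis" "HOL-Library.Landau_Symbols"
begin

text \<open>
  A set of germs at infinity is represented by the set of all its representatives: total functions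
  on the reals, whose values away from a neighbourhood of infinity are irrelevant. Accordingly, the
  set is closed under eventual equality, and a germ is zero if it vanishes eventually.
\<close>

definition hardy_field :: "(real \<Rightarrow> real) set \<Rightarrow> bool" where
  "hardy_field K \<longleftrightarrow>
     (\<forall>a\<in>K. \<forall>b. (\<forall>\<^sub>F t in at_top. a t = b t) \<longrightarrow> b \<in> K) \<and>
     (\<lambda>_. 1) \<in> K \<and>
     (\<forall>a\<in>K. \<forall>b\<in>K. (\<lambda>t. a t - b t) \<in> K \<and> (\<lambda>t. a t * b t) \<in> K) \<and>
     (\<forall>a\<in>K. \<not> (\<forall>\<^sub>F t in at_top. a t = 0) \<longrightarrow> (\<exists>b\<in>K. \<forall>\<^sub>F t in at_top. a t * b t = 1)) \<and>
     (\<forall>a\<in>K. (\<forall>\<^sub>F t in at_top. a differentiable (at t)) \<and> deriv a \<in> K)"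

definition closed_under_composition :: "(real \<Rightarrow> real) set \<Rightarrow> bool" where
  "closed_under_composition K \<longleftrightarrow>
     (\<forall>a\<in>K. \<forall>b\<in>K. filterlim b at_top at_top \<longrightarrow> a \<circ> b \<in> K)"

definition closed_under_inversion :: "(real \<Rightarrow> real) set \<Rightarrow> bool" where
  "closed_under_inversion K \<longleftrightarrow>
     (\<forall>a\<in>K. filterlim a at_top at_top \<longrightarrow>
        (\<exists>b\<in>K. \<forall>\<^sub>F t in at_top. a (b t) = t \<and> b (a t) = t))"

definition poly_growth_part :: "(real \<Rightarrow> real) set \<Rightarrow> (real \<Rightarrow> real) set" where
  "poly_growth_part K = {a \<in> K. \<exists>c>0. a \<in> O[at_top](\<lambda>t. t powr c)}"

definition strongly_nonpolynomial :: "(real \<Rightarrow> real) \<Rightarrow> bool" where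
  "strongly_nonpolynomial a \<longleftrightarrow>
     (\<exists>e::nat. (\<lambda>t. t ^ e) \<in> o[at_top](a) \<and> a \<in> o[at_top](\<lambda>t. t ^ (e + 1)))"

text \<open>Unspecified if the limit does not exist as a real number, as for \<open>exp (- t)\<close>.\<close>

definition fracdeg :: "(real \<Rightarrow> real) \<Rightarrow> real" where
  "fracdeg a = Lim at_top (\<lambda>t. t * deriv a t / a t)"

definition power_smaller :: "(real \<Rightarrow> real) \<Rightarrow> (real \<Rightarrow> real) \<Rightarrow> bool" (infix \<open>\<lless>\<close> 50) where
  "a \<lless> b \<longleftrightarrow> (\<exists>\<delta>>0. (\<lambda>t. \<bar>a t\<bar> * t powr \<delta>) \<in> o[at_top](b))"

definition taylor_approx :: "(real \<Rightarrow> real) \<Rightarrow> nat \<Rightarrow> real \<Rightarrow> real \<Rightarrow> real" where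
  "taylor_approx a k N x = (\<Sum>l=0..k. (deriv ^^ l) a N / fact l * x ^ l)"

text \<open>The function \<open>\<bar>a\<^sup>(\<^sup>k\<^sup>)(N)\<bar>\<^sup>-\<^sup>1\<^sup>/\<^sup>k\<close>; it is only meaningful for \<open>k > 0\<close>.\<close>

definition deriv_scale :: "(real \<Rightarrow> real) \<Rightarrow> nat \<Rightarrow> real \<Rightarrow> real" where
  "deriv_scale a k N = \<bar>(deriv ^^ k) a N\<bar> powr (- 1 / real k)"

definition scales_separated ::
  "(nat \<Rightarrow> real \<Rightarrow> real) \<Rightarrow> nat \<Rightarrow> nat \<Rightarrow> (nat \<Rightarrow> nat) \<Rightarrow> (real \<Rightarrow> real) \<Rightarrow> (real \<Rightarrow> real) \<Rightarrow> bool" where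
  "scales_separated g m m\<^sub>2 D H L \<longleftrightarrow>
     (\<forall>i\<in>{m\<^sub>2+1..m}. \<forall>j\<in>{m\<^sub>2+1..m}.
        deriv_scale (g i) (D i) \<lless> H \<and> H \<lless> L \<and> L \<lless> deriv_scale (g j) (D j + 1))"

definition positive_sublinear :: "(real \<Rightarrow> real) \<Rightarrow> bool" where
  "positive_sublinear a \<longleftrightarrow> (\<forall>\<^sub>F t in at_top. a t > 0) \<and> 0 < fracdeg a \<and> fracdeg a < 1"

text \<open>
  The joint properties of the two scales \<open>H\<close>, \<open>L\<close> and the Taylor degrees \<open>D i\<close>, apart from
  membership of \<open>H\<close>, \<open>L\<close> in the Hardy field. The variable \<open>N\<close> runs through the natural numbers in
  the first two limits, whereas asymptotic relations and fractional degrees refer to functions of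
  a real variable. The maximum is over a finite set, which is nonempty for large \<open>N\<close>.
\<close>

definition good_scales ::
  "(nat \<Rightarrow> real \<Rightarrow> real) \<Rightarrow> nat \<Rightarrow> nat \<Rightarrow> nat \<Rightarrow> (nat \<Rightarrow> nat) \<Rightarrow> (real \<Rightarrow> real) \<Rightarrow> (real \<Rightarrow> real) \<Rightarrow> bool" where
  "good_scales g m m\<^sub>2 q D H L \<longleftrightarrow>
     positive_sublinear H \<and> positive_sublinear L \<and>
     (\<forall>i\<in>{1..m}.
        filterlim (\<lambda>N::nat. \<bar>(deriv ^^ D i) (g i) (real N)\<bar> * real N ^ D i) at_top sequentially \<and>
        (\<lambda>N::nat. MAX n\<in>{n::nat. 1 \<le> n \<and> real n \<le> L (real N)}.
           \<bar>g i (real N + real n) - taylor_approx (g i) (D i) (real N) (real n)\<bar>)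
          \<longlonglongrightarrow> 0) \<and>
     (\<forall>i\<in>{1..m}. if i > m\<^sub>2 then D i \<ge> q else D i = 0) \<and>
     (\<forall>i\<in>{1..m}. \<forall>j\<in>{1..m}. D i = D j \<longleftrightarrow> fracdeg (g i) = fracdeg (g j)) \<and>
     scales_separated g m m\<^sub>2 D H L \<and>
     (\<forall>i\<in>{m\<^sub>2+1..m}.
        fracdeg (deriv_scale (g i) (D i)) \<le> fracdeg (deriv_scale (g m) (D m)) \<and>
        (fracdeg (deriv_scale (g i) (D i)) = fracdeg (deriv_scale (g m) (D m))
           \<longleftrightarrow> fracdeg (g i) = fracdeg (g m))) \<and>
     (\<forall>i\<in>{1..m}. \<forall>j\<in>{1..m}. i \<noteq> j \<longrightarrow>
        (\<lambda>t. (deriv ^^ D i) (g i) t * H t ^ D i)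
          \<notin> \<Theta>[at_top](\<lambda>t. (deriv ^^ D j) (g j) t * H t ^ D j))"

definition H_form :: "(real \<Rightarrow> real) \<Rightarrow> nat \<Rightarrow> real \<Rightarrow> real \<Rightarrow> real" where
  "H_form a k \<eta> N = (if k > 0 then deriv_scale a k N * N powr \<eta> else N powr \<eta>)"

end

theory Submission imports Defs begin

text \<open>
  Write \<open>a i\<close> for the fractional degree of \<open>g i\<close>. The heart of the matter is that a strongly
  nonpolynomial function of degree \<open>a\<close> in a Hardy field has a \<open>k\<close>-th derivative of degree exactly
  \<open>a - k\<close>, for every \<open>k\<close> (lemma \<open>has_fracdeg_higher_deriv\<close>). Hence \<open>\<bar>g\<^sup>(\<^sup>k\<^sup>)\<bar>\<^sup>-\<^sup>1\<^sup>/\<^sup>k\<close> has degree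
  \<open>1 - a / k\<close>, and all conditions on the two scales turn into inequalities between real numbers.

  Both that fact and the preservation of \<open>\<prec>\<close> under differentiation come from a converse of
  l'Hopital's rule (lemma \<open>converse_lhopital\<close>): a quotient \<open>f' / g'\<close> of elements of a Hardy field has
  a limit in the extended reals, and Cauchy's mean value theorem forces it to be the limit of
  \<open>f / g\<close>. With \<open>f = t g'\<close> this computes the degree of \<open>g'\<close>. The rule fails when \<open>g\<close> tends to a
  nonzero constant; that no derivative of a strongly nonpolynomial function does so is
  recorded by the property \<open>avoids_monomials\<close>, which is inherited by derivatives.

  The inequalities ask for a slope \<open>\<rho> < 1\<close> with \<open>a i / (D i + 1) < \<rho> \<le> a i / D i\<close> for all \<open>i\<close> of
  positive degree, where \<open>\<rho> = a m / D m\<close> and equality on the right means \<open>a i = a m\<close>. So, for a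
  large integer \<open>M\<close>, let \<open>D i\<close> be the integer part of \<open>M a i / a m\<close>; the inequality on the right is
  strict as soon as \<open>M a i / a m\<close> is not an integer, which is arranged by taking \<open>M\<close> to be \<open>1\<close> modulo
  the denominators of the rational ones among the ratios \<open>a i / a m < 1\<close>
  (lemma \<open>taylor_degrees_exist\<close>). Large \<open>M\<close> also makes the \<open>D i\<close> large, and different for
  different \<open>a i\<close>.

  The function \<open>H\<close> then has degree \<open>1 - \<rho> + \<eta>\<close>, and the term \<open>g\<^sub>i\<^sup>(\<^sup>D\<^sup>i\<^sup>) H\<^sup>D\<^sup>i\<close> has degree
  \<open>a i - D i (\<rho> - \<eta>)\<close>. Two such expressions with different \<open>D i\<close> agree for at most one \<open>\<eta>\<close>, so all of
  them are distinct for small \<open>\<eta>\<close>; if \<open>D i = D j\<close>, the terms are compared through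
  \<open>g i \<prec> g j\<close>. Finally, \<open>g\<^sub>i\<^sup>(\<^sup>D\<^sup>i\<^sup>+\<^sup>1\<^sup>)\<close> has negative degree, so its modulus is eventually decreasing
  and the Lagrange remainder on \<open>[N, N + L(N)]\<close> is at most \<open>\<bar>g\<^sub>i\<^sup>(\<^sup>D\<^sup>i\<^sup>+\<^sup>1\<^sup>)(N)\<bar> L(N)\<^sup>D\<^sup>i\<^sup>+\<^sup>1\<close>, which tends to \<open>0\<close>.

  A Hardy field that is closed under composition and inversion and has an unbounded element contains
  the rational powers of \<open>t\<close>, though possibly no others. They suffice to obtain \<open>H\<close> and \<open>L\<close> in the
  field, since \<open>\<eta>\<close> and the exponent of \<open>L\<close> range over open intervals.
\<close>

section \<open>Functions with a fractional degree\<close>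

text \<open>
  The constant \<open>fracdeg\<close> is a limit operator with an unspecified value if there is no limit. This
  predicate also asserts convergence; it does not refer to a Hardy field, because \<open>t powr \<eta>\<close> need not
  belong to the given one.
\<close>

definition has_fracdeg :: "(real \<Rightarrow> real) \<Rightarrow> real \<Rightarrow> bool" where
  "has_fracdeg f a \<longleftrightarrow> (\<forall>\<^sub>F t in at_top. f differentiable (at t) \<and> f t \<noteq> 0) \<and>
     ((\<lambda>t. t * deriv f t / f t) \<longlongrightarrow> a) at_top"

lemma has_fracdegI:
  assumes "\<forall>\<^sub>F t in at_top. (f has_real_derivative f' t) (at t) \<and> f t \<noteq> 0"
    and "((\<lambda>t. t * f' t / f t) \<longlongrightarrow> a) at_top"
  shows "has_fracdeg f a"
  unfolding has_fracdeg_def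
proof
  show "\<forall>\<^sub>F t in at_top. f differentiable (at t) \<and> f t \<noteq> 0"
    using assms(1) by eventually_elim (auto simp: real_differentiable_def)
  show "((\<lambda>t. t * deriv f t / f t) \<longlongrightarrow> a) at_top"
    by (rule Lim_transform_eventually[OF assms(2)])
      (use assms(1) in \<open>eventually_elim, auto dest: DERIV_imp_deriv\<close>)
qed

lemma has_fracdegD:
  assumes "has_fracdeg f a"
  shows "\<forall>\<^sub>F t in at_top. (f has_real_derivative deriv f t) (at t)"
    and "\<forall>\<^sub>F t in at_top. f t \<noteq> 0"
    and "((\<lambda>t. t * deriv f t / f t) \<longlongrightarrow> a) at_top"
    and "fracdeg f = a"
proof -
  show "\<forall>\<^sub>F t in at_top. (f has_real_derivative deriv f t) (at t)"
    using assms unfolding has_fracdeg_def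
    by (auto elim!: eventually_mono simp: DERIV_deriv_iff_real_differentiable)
  show "\<forall>\<^sub>F t in at_top. f t \<noteq> 0"
    using assms unfolding has_fracdeg_def by (auto elim!: eventually_mono)
  show lim: "((\<lambda>t. t * deriv f t / f t) \<longlongrightarrow> a) at_top"
    using assms unfolding has_fracdeg_def by auto
  show "fracdeg f = a"
    unfolding fracdeg_def using lim by (intro tendsto_Lim) auto
qed

lemma has_fracdeg_powr: "has_fracdeg (\<lambda>t. t powr c) c"
proof (rule has_fracdegI[where f' = "\<lambda>t. c * t powr (c - 1)"])
  show "\<forall>\<^sub>F t in at_top. ((\<lambda>t. t powr c) has_real_derivative c * t powr (c - 1)) (at t) \<and> t powr c \<noteq> 0"
    using eventually_gt_at_top[of 0]
    by eventually_elim (auto intro!: derivative_eq_intros simp: powr_diff)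
  have "\<forall>\<^sub>F t in at_top. c = t * (c * t powr (c - 1)) / t powr c"
    using eventually_gt_at_top[of 0]
    by eventually_elim (auto simp: powr_diff)
  from Lim_transform_eventually[OF tendsto_const this]
  show "((\<lambda>t. t * (c * t powr (c - 1)) / t powr c) \<longlongrightarrow> c) at_top" .
qed

lemma has_fracdeg_mult:
  assumes "has_fracdeg f a" "has_fracdeg g b"
  shows "has_fracdeg (\<lambda>t. f t * g t) (a + b)"
proof (rule has_fracdegI[where f' = "\<lambda>t. deriv f t * g t + deriv g t * f t"])
  note f = has_fracdegD[OF assms(1)] and g = has_fracdegD[OF assms(2)]
  show "\<forall>\<^sub>F t in at_top. ((\<lambda>t. f t * g t) has_real_derivative
      deriv f t * g t + deriv g t * f t) (at t) \<and> f t * g t \<noteq> 0"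
    using f(1,2) g(1,2) by eventually_elim (auto intro!: DERIV_mult)
  show "((\<lambda>t. t * (deriv f t * g t + deriv g t * f t) / (f t * g t)) \<longlongrightarrow> a + b) at_top"
    by (rule Lim_transform_eventually[OF tendsto_add[OF f(3) g(3)]])
      (use f(2) g(2) in \<open>eventually_elim, auto simp: field_simps\<close>)
qed

lemma has_fracdeg_abs_powr:
  assumes "has_fracdeg f a"
  shows "has_fracdeg (\<lambda>t. \<bar>f t\<bar> powr c) (c * a)"
proof (rule has_fracdegI[where f' = "\<lambda>t. c * \<bar>f t\<bar> powr c * (deriv f t / f t)"])
  note f = has_fracdegD[OF assms(1)]
  have D: "((\<lambda>x. \<bar>x\<bar> powr c) has_real_derivative c * \<bar>x\<bar> powr c / x) (at x)" if "x \<noteq> 0" for x :: real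
  proof -
    have "((\<lambda>x. (x\<^sup>2) powr (c / 2)) has_real_derivative c * (x\<^sup>2) powr (c / 2) / x) (at x)"
    proof (rule DERIV_cong)
      show "((\<lambda>x. (x\<^sup>2) powr (c / 2)) has_real_derivative c / 2 * (x\<^sup>2) powr (c / 2 - 1) * (2 * x)) (at x)"
        using that by (auto intro!: derivative_eq_intros)
      show "c / 2 * (x\<^sup>2) powr (c / 2 - 1) * (2 * x) = c * (x\<^sup>2) powr (c / 2) / x"
        using that by (simp add: powr_diff power2_eq_square)
    qed
    moreover have "(y\<^sup>2) powr (c / 2) = \<bar>y\<bar> powr c" for y :: real
      using powr_powr[of "\<bar>y\<bar>" 2 "c / 2"] by simp
    ultimately show ?thesis by simp
  qed
  show "\<forall>\<^sub>F t in at_top. ((\<lambda>t. \<bar>f t\<bar> powr c) has_real_derivative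
      c * \<bar>f t\<bar> powr c * (deriv f t / f t)) (at t) \<and> \<bar>f t\<bar> powr c \<noteq> 0"
    using f(1,2)
  proof eventually_elim
    case (elim t)
    from DERIV_chain2[OF D elim(1)] elim(2) show ?case by (simp add: field_simps)
  qed
  show "((\<lambda>t. t * (c * \<bar>f t\<bar> powr c * (deriv f t / f t)) / \<bar>f t\<bar> powr c) \<longlongrightarrow> c * a) at_top"
    by (rule Lim_transform_eventually[OF tendsto_mult_left[OF f(3), of c]])
      (use f(2) in \<open>eventually_elim, auto\<close>)
qed

lemma has_fracdeg_abs:
  assumes "has_fracdeg f a" shows "has_fracdeg (\<lambda>t. \<bar>f t\<bar>) a"
  using has_fracdeg_abs_powr[OF assms, of 1] by simp

lemma has_fracdeg_inverse:
  assumes "has_fracdeg f a" shows "has_fracdeg (\<lambda>t. inverse (f t)) (- a)"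
proof (rule has_fracdegI[where f' = "\<lambda>t. - deriv f t / (f t)\<^sup>2"])
  note f = has_fracdegD[OF assms(1)]
  show "\<forall>\<^sub>F t in at_top. ((\<lambda>t. inverse (f t)) has_real_derivative - deriv f t / (f t)\<^sup>2) (at t)
      \<and> inverse (f t) \<noteq> 0"
    using f(1,2) by eventually_elim (auto intro!: derivative_eq_intros simp: power2_eq_square field_simps)
  show "((\<lambda>t. t * (- deriv f t / (f t)\<^sup>2) / inverse (f t)) \<longlongrightarrow> - a) at_top"
    by (rule Lim_transform_eventually[OF tendsto_minus[OF f(3)]])
      (use f(2) in \<open>eventually_elim, auto simp: power2_eq_square field_simps\<close>)
qed

lemma has_fracdeg_divide:
  assumes "has_fracdeg f a" "has_fracdeg g b"
  shows "has_fracdeg (\<lambda>t. f t / g t) (a - b)"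
  using has_fracdeg_mult[OF assms(1) has_fracdeg_inverse[OF assms(2)]] by (simp add: divide_inverse)

lemma has_fracdeg_power:
  assumes "has_fracdeg f a" shows "has_fracdeg (\<lambda>t. f t ^ n) (real n * a)"
proof (induction n)
  case 0
  show ?case by (rule has_fracdegI[where f' = "\<lambda>_. 0"]) auto
next
  case (Suc n)
  from has_fracdeg_mult[OF assms Suc] show ?case by (simp add: algebra_simps)
qed

lemma powr_at_top:
  fixes c :: real
  assumes "c > 0"
  shows "filterlim (\<lambda>t. t powr c) at_top at_top"
proof (rule filterlim_at_top_mono)
  show "filterlim (\<lambda>t. exp (c * ln t)) at_top at_top"
    using assms by (intro filterlim_compose[OF exp_at_top]
      filterlim_tendsto_pos_mult_at_top[OF tendsto_const] ln_at_top) auto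
  show "\<forall>\<^sub>F t in at_top. exp (c * ln t) \<le> t powr c"
    using eventually_gt_at_top[of 0] by eventually_elim (auto simp: powr_def)
qed

text \<open>
  A lower bound \<open>c\<close> for the logarithmic derivative with respect to \<open>ln t\<close> says that \<open>f t / t powr c\<close>
  is nondecreasing in modulus. Squaring avoids a distinction by the sign of \<open>f\<close>.
\<close>

lemma power_lower_bound:
  assumes d: "\<forall>\<^sub>F t in at_top. (f has_real_derivative deriv f t) (at t)"
    and nz: "\<forall>\<^sub>F t in at_top. f t \<noteq> 0"
    and le: "\<forall>\<^sub>F t in at_top. c \<le> t * deriv f t / f t"
  shows "\<exists>C>0. \<forall>\<^sub>F t in at_top. C * t powr c \<le> \<bar>f t\<bar>"
proof -
  have "\<forall>\<^sub>F t in at_top. t > 0 \<and> (f has_real_derivative deriv f t) (at t) \<and> f t \<noteq> 0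
      \<and> c \<le> t * deriv f t / f t"
    using d nz le eventually_gt_at_top[of 0] by eventually_elim auto
  then obtain T where T: "\<And>t. t \<ge> T \<Longrightarrow> t > 0 \<and> (f has_real_derivative deriv f t) (at t) \<and> f t \<noteq> 0
      \<and> c \<le> t * deriv f t / f t"
    unfolding eventually_at_top_linorder by blast
  \<comment> \<open>the square of \<open>f t / t powr c\<close>\<close>
  define p where "p t = (f t)\<^sup>2 * t powr (- 2 * c)" for t
  have mono: "p T \<le> p t" if "t \<ge> T" for t
  proof (rule DERIV_nonneg_imp_nondecreasing[OF that])
    fix x assume "T \<le> x"
    note x = T[OF this]
    let ?y = "2 * (f x)\<^sup>2 * x powr (- 2 * c) / x * (x * deriv f x / f x - c)"
    have "(p has_real_derivative ?y) (at x)"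
      unfolding p_def using x
      by (auto intro!: derivative_eq_intros simp: powr_diff power2_eq_square field_simps)
    moreover have "?y \<ge> 0" using x by (intro mult_nonneg_nonneg divide_nonneg_pos) auto
    ultimately show "\<exists>y. (p has_real_derivative y) (at x) \<and> 0 \<le> y" by blast
  qed
  have pT: "p T > 0" using T[of T] by (auto simp: p_def)
  show ?thesis
  proof (intro exI[of _ "sqrt (p T)"] conjI)
    show "sqrt (p T) > 0" using pT by simp
    show "\<forall>\<^sub>F t in at_top. sqrt (p T) * t powr c \<le> \<bar>f t\<bar>"
      using eventually_ge_at_top[of T]
    proof eventually_elim
      case (elim t)
      have t: "t > 0" using T[OF elim] by simp
      have "t powr c * t powr c = t powr (2 * c)" by (simp flip: powr_add)
      have "p T * (t powr c)\<^sup>2 \<le> p t * (t powr c)\<^sup>2" using mono[OF elim] by (intro mult_right_mono) auto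
      also have "\<dots> = (f t)\<^sup>2 * (t powr (- 2 * c) * (t powr c * t powr c))"
        by (simp add: p_def power2_eq_square)
      also have "t powr (- 2 * c) * (t powr c * t powr c) = 1"
        using t by (simp flip: powr_add)
      finally have "p T * (t powr c)\<^sup>2 \<le> (f t)\<^sup>2" by simp
      then have "sqrt (p T * (t powr c)\<^sup>2) \<le> sqrt ((f t)\<^sup>2)" by (rule real_sqrt_le_mono)
      then show ?case by (simp add: real_sqrt_mult)
    qed
  qed
qed

lemma has_fracdeg_pos_imp_at_top:
  assumes "has_fracdeg f a" "a > 0"
  shows "filterlim (\<lambda>t. \<bar>f t\<bar>) at_top at_top"
proof -
  have "\<forall>\<^sub>F t in at_top. a / 2 < t * deriv f t / f t"
    using has_fracdegD(3)[OF assms(1)] assms(2) by (intro order_tendstoD) auto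
  then have "\<forall>\<^sub>F t in at_top. a / 2 \<le> t * deriv f t / f t" by eventually_elim auto
  from power_lower_bound[OF has_fracdegD(1,2)[OF assms(1)] this]
  obtain C where C: "C > 0" "\<forall>\<^sub>F t in at_top. C * t powr (a / 2) \<le> \<bar>f t\<bar>" by blast
  have "filterlim (\<lambda>t::real. C * t powr (a / 2)) at_top at_top"
    using C(1) assms(2) by (intro filterlim_tendsto_pos_mult_at_top[OF tendsto_const] powr_at_top) auto
  from filterlim_at_top_mono[OF this C(2)] show ?thesis .
qed

lemma has_fracdeg_neg_imp_tendsto_0:
  assumes "has_fracdeg f a" "a < 0"
  shows "(f \<longlongrightarrow> 0) at_top"
proof -
  have "filterlim (\<lambda>t. \<bar>inverse (f t)\<bar>) at_top at_top"
    using has_fracdeg_inverse[OF assms(1)] assms(2) by (intro has_fracdeg_pos_imp_at_top) auto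
  then have "filterlim (\<lambda>t. inverse (f t)) at_infinity at_top"
    by (simp add: filterlim_at_infinity_conv_norm_at_top)
  then have "((\<lambda>t. inverse (inverse (f t))) \<longlongrightarrow> 0) at_top"
    by (rule filterlim_compose[OF tendsto_inverse_0])
  then show ?thesis by simp
qed

lemma has_fracdeg_less_imp_smallo:
  assumes "has_fracdeg f a" "has_fracdeg g b" "a < b"
  shows "f \<in> o[at_top](g)"
  using has_fracdeg_divide[OF assms(1,2)] assms(3) has_fracdegD(2)[OF assms(2)]
  by (intro smalloI_tendsto has_fracdeg_neg_imp_tendsto_0) auto

lemma smallo_imp_fracdeg_le:
  assumes "has_fracdeg f a" "has_fracdeg g b" "f \<in> o[at_top](g)"
  shows "a \<le> b"
proof (rule ccontr)
  assume "\<not> a \<le> b"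
  then have "g \<in> o[at_top](f)" using has_fracdeg_less_imp_smallo[OF assms(2,1)] by simp
  from landau_o.small_asymmetric[OF assms(3) this] has_fracdegD(2)[OF assms(1)]
  have "\<forall>\<^sub>F t in at_top::real filter. False" by eventually_elim auto
  then show False by simp
qed

lemma has_fracdeg_less_imp_power_smaller:
  assumes "has_fracdeg f a" "has_fracdeg g b" "a < b"
  shows "f \<lless> g"
  unfolding power_smaller_def
proof (intro exI conjI)
  show "(b - a) / 2 > 0" using assms(3) by simp
  show "(\<lambda>t. \<bar>f t\<bar> * t powr ((b - a) / 2)) \<in> o[at_top](g)"
    by (rule has_fracdeg_less_imp_smallo[OF has_fracdeg_mult[OF has_fracdeg_abs[OF assms(1)]
      has_fracdeg_powr] assms(2)]) (use assms(3) in \<open>simp add: field_simps\<close>)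
qed

lemma has_fracdeg_distinct_imp_not_bigtheta:
  assumes "has_fracdeg f a" "has_fracdeg g b" "a \<noteq> b"
  shows "f \<notin> \<Theta>[at_top](g)"
proof
  assume th: "f \<in> \<Theta>[at_top](g)"
  then have th': "f \<in> O[at_top](g)" "g \<in> O[at_top](f)" by (auto simp: bigtheta_def bigomega_iff_bigo)
  have "(\<forall>\<^sub>F t in at_top. f t = 0) \<or> (\<forall>\<^sub>F t in at_top. g t = 0)"
  proof (cases "a < b")
    case True
    from landau_o.small_big_asymmetric[OF has_fracdeg_less_imp_smallo[OF assms(1,2) True] th'(2)]
    show ?thesis ..
  next
    case False
    then have "b < a" using assms(3) by simp
    from landau_o.small_big_asymmetric[OF has_fracdeg_less_imp_smallo[OF assms(2,1) this] th'(1)]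
    show ?thesis ..
  qed
  then have "\<forall>\<^sub>F t in at_top::real filter. False"
  proof
    assume "\<forall>\<^sub>F t in at_top. f t = 0"
    with has_fracdegD(2)[OF assms(1)] show ?thesis by eventually_elim auto
  next
    assume "\<forall>\<^sub>F t in at_top. g t = 0"
    with has_fracdegD(2)[OF assms(2)] show ?thesis by eventually_elim auto
  qed
  then show False by simp
qed

text \<open>
  The quotient \<open>t f' / f\<close> has the sign of the derivative of \<open>f\<^sup>2\<close>. This is what bounds a Lagrange
  remainder by the value at the left end of the interval.
\<close>

lemma has_fracdeg_neg_imp_abs_decreasing:
  assumes "has_fracdeg f a" "a < 0"
  shows "\<exists>T. \<forall>s t. T \<le> s \<and> s \<le> t \<longrightarrow> \<bar>f t\<bar> \<le> \<bar>f s\<bar>"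
proof -
  note f = has_fracdegD[OF assms(1)]
  have "\<forall>\<^sub>F t in at_top. t * deriv f t / f t < 0"
    using f(3) assms(2) by (rule order_tendstoD)
  with f(1,2) eventually_gt_at_top[of 0]
  have "\<forall>\<^sub>F t in at_top. t > 0 \<and> (f has_real_derivative deriv f t) (at t) \<and> f t \<noteq> 0
      \<and> t * deriv f t / f t < 0"
    by eventually_elim auto
  then obtain T where T: "\<And>t. t \<ge> T \<Longrightarrow> t > 0 \<and> (f has_real_derivative deriv f t) (at t) \<and> f t \<noteq> 0
      \<and> t * deriv f t / f t < 0"
    unfolding eventually_at_top_linorder by blast
  have "\<bar>f t\<bar> \<le> \<bar>f s\<bar>" if "T \<le> s" "s \<le> t" for s t
  proof -
    have "(f t)\<^sup>2 \<le> (f s)\<^sup>2"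
    proof (rule DERIV_nonpos_imp_nonincreasing[OF that(2)])
      fix x assume "s \<le> x" "x \<le> t"
      then have x: "x > 0" "(f has_real_derivative deriv f x) (at x)" "f x \<noteq> 0"
        "x * deriv f x / f x < 0" using T[of x] that by auto
      have "((\<lambda>x. (f x)\<^sup>2) has_real_derivative 2 * f x * deriv f x) (at x)"
        using x(2) by (auto intro!: derivative_eq_intros)
      moreover have "2 * f x * deriv f x \<le> 0"
        using x(1,3,4) by (auto simp: divide_less_0_iff mult_less_0_iff zero_less_mult_iff mult_le_0_iff)
      ultimately show "\<exists>y. ((\<lambda>x. (f x)\<^sup>2) has_real_derivative y) (at x) \<and> y \<le> 0" by blast
    qed
    then show ?thesis by (simp add: abs_le_square_iff)
  qed
  then show ?thesis by blast
qed

section \<open>Limits in Hardy fields and a converse of the rule of l'Hopital\<close>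

lemma monotone_imp_limit_or_at_top:
  fixes f :: "real \<Rightarrow> real"
  assumes "\<And>s t. T \<le> s \<Longrightarrow> s \<le> t \<Longrightarrow> f s \<le> f t"
  shows "(\<exists>l. (f \<longlongrightarrow> l) at_top) \<or> filterlim f at_top at_top"
proof (cases "bdd_above (f ` {T..})")
  case True
  have "(f \<longlongrightarrow> Sup (f ` {T..})) at_top"
  proof (rule increasing_tendsto)
    show "\<forall>\<^sub>F t in at_top. f t \<le> Sup (f ` {T..})"
      using eventually_ge_at_top[of T] by eventually_elim (use True in \<open>auto intro!: cSup_upper\<close>)
    fix x assume "x < Sup (f ` {T..})"
    then obtain s where "s \<ge> T" "x < f s" using less_cSup_iff[of "f ` {T..}" x] True by auto
    show "\<forall>\<^sub>F t in at_top. x < f t"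
      using eventually_ge_at_top[of s]
      by eventually_elim (use assms[OF \<open>s \<ge> T\<close>] \<open>x < f s\<close> in force)
  qed
  then show ?thesis by blast
next
  case False
  have "filterlim f at_top at_top"
    unfolding filterlim_at_top
  proof
    fix Z
    from False have "\<not> (\<forall>y\<in>f ` {T..}. y \<le> Z)" unfolding bdd_above_def by blast
    then obtain s where "s \<ge> T" "Z \<le> f s" by force
    show "\<forall>\<^sub>F t in at_top. Z \<le> f t"
      using eventually_ge_at_top[of s]
      by eventually_elim (use assms[OF \<open>s \<ge> T\<close>] \<open>Z \<le> f s\<close> in force)
  qed
  then show ?thesis by blast
qed

text \<open>
  By Cauchy's mean value theorem, \<open>(f t - f s) / (g t - g s)\<close> is a value of \<open>f' / g'\<close> and hence at
  least \<open>c\<close>. If \<open>\<bar>g\<bar>\<close> tends to infinity, this quotient has the same limit as \<open>f t / g t\<close> for fixed \<open>s\<close>;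
  if \<open>f\<close> and \<open>g\<close> vanish at infinity, it tends to \<open>f s / g s\<close>.
\<close>

lemma quotient_limit_ge:
  assumes df: "\<forall>\<^sub>F t in at_top. (f has_real_derivative f' t) (at t)"
    and dg: "\<forall>\<^sub>F t in at_top. (g has_real_derivative g' t) (at t)"
    and g': "\<forall>\<^sub>F t in at_top. g' t \<noteq> 0"
    and le: "\<forall>\<^sub>F t in at_top. c \<le> f' t / g' t"
    and nz: "\<forall>\<^sub>F t in at_top. g t \<noteq> 0"
    and lim: "((\<lambda>t. f t / g t) \<longlongrightarrow> x) at_top"
    and cases: "filterlim g at_infinity at_top \<or> (f \<longlongrightarrow> 0) at_top \<and> (g \<longlongrightarrow> 0) at_top"
  shows "c \<le> (x :: real)"
proof -
  have "\<forall>\<^sub>F t in at_top. (f has_real_derivative f' t) (at t) \<and> (g has_real_derivative g' t) (at t) \<and>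
      g' t \<noteq> 0 \<and> c \<le> f' t / g' t \<and> g t \<noteq> 0"
    using df dg g' le nz by eventually_elim auto
  then obtain T where T: "\<And>t. t \<ge> T \<Longrightarrow> (f has_real_derivative f' t) (at t) \<and>
      (g has_real_derivative g' t) (at t) \<and> g' t \<noteq> 0 \<and> c \<le> f' t / g' t \<and> g t \<noteq> 0"
    unfolding eventually_at_top_linorder by blast
  have quot: "c \<le> (f t - f s) / (g t - g s)" if "T \<le> s" "s < t" for s t
  proof -
    have Dx: "(f has_real_derivative f' x) (at x)" "(g has_real_derivative g' x) (at x)"
      if "s \<le> x" for x using T[of x] that \<open>T \<le> s\<close> by auto
    have isC: "\<forall>x. s \<le> x \<and> x \<le> t \<longrightarrow> isCont f x" "\<forall>x. s \<le> x \<and> x \<le> t \<longrightarrow> isCont g x"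
      using Dx DERIV_isCont by blast+
    have diff: "\<forall>x. s < x \<and> x < t \<longrightarrow> f differentiable (at x)"
      "\<forall>x. s < x \<and> x < t \<longrightarrow> g differentiable (at x)"
      using Dx by (meson less_imp_le real_differentiable_def)+
    from GMVT[OF \<open>s < t\<close> isC(1) diff(1) isC(2) diff(2)]
    obtain g'c f'c z where z: "(g has_real_derivative g'c) (at z)" "(f has_real_derivative f'c) (at z)"
      "s < z" "z < t" "(f t - f s) * g'c = (g t - g s) * f'c" by blast
    from T[of z] z(3,4) that have Tz: "(f has_real_derivative f' z) (at z)"
      "(g has_real_derivative g' z) (at z)" "g' z \<noteq> 0" "c \<le> f' z / g' z" by auto
    have eq: "(f t - f s) * g' z = (g t - g s) * f' z"
      using z(5) DERIV_unique[OF z(1) Tz(2)] DERIV_unique[OF z(2) Tz(1)] by simp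
    have "g t - g s \<noteq> 0"
    proof
      assume "g t - g s = 0"
      then have "g s = g t" by simp
      obtain y where y: "s < y" "y < t" "(g has_real_derivative 0) (at y)"
      proof (rule Rolle[OF \<open>s < t\<close> \<open>g s = g t\<close>, THEN exE])
        show "continuous_on {s..t} g" using isC(2) by (intro continuous_at_imp_continuous_on) auto
        show "g differentiable (at x)" if "s < x" "x < t" for x using diff(2) that by blast
      qed (use that in blast)
      with T[of y] \<open>T \<le> s\<close> DERIV_unique[OF y(3), of "g' y"] show False by auto
    qed
    with eq Tz(3) have "(f t - f s) / (g t - g s) = f' z / g' z" by (simp add: frac_eq_eq mult.commute)
    with Tz(4) show ?thesis by simp
  qed
  from cases show ?thesis
  proof
    assume ginf: "filterlim g at_infinity at_top"
    have inv: "((\<lambda>t. inverse (g t)) \<longlongrightarrow> 0) at_top"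
      by (rule filterlim_compose[OF tendsto_inverse_0 ginf])
    have "((\<lambda>t. (f t / g t - f T * inverse (g t)) / (1 - g T * inverse (g t)))
        \<longlongrightarrow> (x - f T * 0) / (1 - g T * 0)) at_top"
      by (intro tendsto_intros lim inv) auto
    then have "((\<lambda>t. (f t / g t - f T * inverse (g t)) / (1 - g T * inverse (g t))) \<longlongrightarrow> x) at_top"
      by simp
    moreover have "\<forall>\<^sub>F t in at_top. c \<le> (f t / g t - f T * inverse (g t)) / (1 - g T * inverse (g t))"
      using eventually_gt_at_top[of T] nz
    proof eventually_elim
      case (elim t)
      have "(f t / g t - f T * inverse (g t)) / (1 - g T * inverse (g t))
          = ((f t - f T) / g t) / ((g t - g T) / g t)"
        using elim(2) by (simp add: divide_inverse algebra_simps)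
      with quot[of T t] elim show ?case by simp
    qed
    ultimately show "c \<le> x" by (intro tendsto_lowerbound) auto
  next
    assume zero: "(f \<longlongrightarrow> 0) at_top \<and> (g \<longlongrightarrow> 0) at_top"
    have "c \<le> f s / g s" if s: "s \<ge> T" for s
    proof -
      have "((\<lambda>t. (f t - f s) / (g t - g s)) \<longlongrightarrow> (0 - f s) / (0 - g s)) at_top"
        using zero T[OF s] by (intro tendsto_intros) auto
      moreover have "\<forall>\<^sub>F t in at_top. c \<le> (f t - f s) / (g t - g s)"
        using eventually_gt_at_top[of s] by eventually_elim (use quot s in auto)
      ultimately have "c \<le> (0 - f s) / (0 - g s)" by (intro tendsto_lowerbound) auto
      then show ?thesis by simp
    qed
    then have "\<forall>\<^sub>F t in at_top. c \<le> f t / g t"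
      unfolding eventually_at_top_linorder by blast
    with lim show "c \<le> x" by (intro tendsto_lowerbound) auto
  qed
qed

locale hardy =
  fixes K :: "(real \<Rightarrow> real) set"
  assumes hardy_field: "hardy_field K"
begin

lemma cong_mem: "a \<in> K \<Longrightarrow> \<forall>\<^sub>F t in at_top. a t = b t \<Longrightarrow> b \<in> K"
  using hardy_field unfolding hardy_field_def by blast

lemma one_mem: "(\<lambda>_. 1) \<in> K"
  using hardy_field unfolding hardy_field_def by blast

lemma diff_mem: "a \<in> K \<Longrightarrow> b \<in> K \<Longrightarrow> (\<lambda>t. a t - b t) \<in> K"
  and mult_mem: "a \<in> K \<Longrightarrow> b \<in> K \<Longrightarrow> (\<lambda>t. a t * b t) \<in> K"
  using hardy_field unfolding hardy_field_def by blast+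

lemma deriv_mem: "a \<in> K \<Longrightarrow> deriv a \<in> K"
  using hardy_field unfolding hardy_field_def by blast

lemma has_deriv:
  assumes "a \<in> K" shows "\<forall>\<^sub>F t in at_top. (a has_real_derivative deriv a t) (at t)"
proof -
  have "\<forall>\<^sub>F t in at_top. a differentiable (at t)"
    using hardy_field assms unfolding hardy_field_def by blast
  then show ?thesis by eventually_elim (simp add: DERIV_deriv_iff_real_differentiable)
qed

lemma uminus_mem: "a \<in> K \<Longrightarrow> (\<lambda>t. - a t) \<in> K"
  using diff_mem[OF diff_mem[OF one_mem one_mem], of a] by simp

lemma power_mem: "a \<in> K \<Longrightarrow> (\<lambda>t. a t ^ n) \<in> K"
  by (induction n) (auto intro: one_mem mult_mem)

lemma eventually_zero_or_nonzero:
  assumes "a \<in> K"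
  shows "(\<forall>\<^sub>F t in at_top. a t = 0) \<or> (\<forall>\<^sub>F t in at_top. a t \<noteq> 0)"
proof (rule disjCI)
  assume "\<not> (\<forall>\<^sub>F t in at_top. a t \<noteq> 0)"
  show "\<forall>\<^sub>F t in at_top. a t = 0"
  proof (rule ccontr)
    assume "\<not> ?thesis"
    with assms hardy_field obtain b where "\<forall>\<^sub>F t in at_top. a t * b t = 1"
      unfolding hardy_field_def by blast
    then have "\<forall>\<^sub>F t in at_top. a t \<noteq> 0" by eventually_elim auto
    with \<open>\<not> (\<forall>\<^sub>F t in at_top. a t \<noteq> 0)\<close> show False by blast
  qed
qed

text \<open>
  With \<open>inverse 0 = 0\<close>, the zero germ is its own inverse, so that no case distinctions arise
  in later applications.
\<close>

lemma inverse_mem: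
  assumes "a \<in> K" shows "(\<lambda>t. inverse (a t)) \<in> K"
proof (cases "\<forall>\<^sub>F t in at_top. a t = 0")
  case True
  then have "\<forall>\<^sub>F t in at_top. a t = inverse (a t)" by eventually_elim auto
  with assms show ?thesis by (rule cong_mem)
next
  case False
  with assms hardy_field obtain b where b: "b \<in> K" "\<forall>\<^sub>F t in at_top. a t * b t = 1"
    unfolding hardy_field_def by blast
  from b(2) have "\<forall>\<^sub>F t in at_top. b t = inverse (a t)"
    by eventually_elim (metis inverse_unique)
  with b(1) show ?thesis by (rule cong_mem)
qed

lemma divide_mem: "a \<in> K \<Longrightarrow> b \<in> K \<Longrightarrow> (\<lambda>t. a t / b t) \<in> K"
  using mult_mem[OF _ inverse_mem] by (simp add: divide_inverse)

text \<open>
  Elements of the field are eventually continuous, so the intermediate value theorem applies.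
\<close>

lemma eventually_signed:
  assumes "a \<in> K" "\<forall>\<^sub>F t in at_top. a t \<noteq> 0"
  shows "(\<forall>\<^sub>F t in at_top. a t > 0) \<or> (\<forall>\<^sub>F t in at_top. a t < 0)"
proof -
  have "\<forall>\<^sub>F t in at_top. (a has_real_derivative deriv a t) (at t) \<and> a t \<noteq> 0"
    using has_deriv[OF assms(1)] assms(2) by eventually_elim auto
  then obtain T where T: "\<And>t. t \<ge> T \<Longrightarrow> (a has_real_derivative deriv a t) (at t) \<and> a t \<noteq> 0"
    unfolding eventually_at_top_linorder by blast
  have cont: "continuous_on {T..} a"
    using T by (intro continuous_at_imp_continuous_on) (auto intro!: DERIV_isCont)
  have conn: "connected (a ` {T..})"
    by (rule connected_continuous_image[OF cont]) (simp add: connected_iff_interval)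
  have "0 \<notin> a ` {T..}" using T by force
  have "(\<forall>t\<ge>T. a t > 0) \<or> (\<forall>t\<ge>T. a t < 0)"
  proof (rule ccontr)
    assume "\<not> ?thesis"
    then obtain s t where "s \<ge> T" "t \<ge> T" "a s \<le> 0" "a t \<ge> 0" by (auto simp: not_less)
    with connectedD_interval[OF conn, of "a s" "a t" 0] \<open>0 \<notin> _\<close> show False by auto
  qed
  then show ?thesis unfolding eventually_at_top_linorder by blast
qed

text \<open>
  The derivative is an element of the field and has eventually constant sign, so every element is
  eventually monotone.
\<close>

lemma limit_cases:
  assumes "a \<in> K"
  obtains l where "(a \<longlongrightarrow> l) at_top" | "filterlim a at_top at_top" | "filterlim a at_bot at_top"
proof -
  have mono: "(\<exists>l. (b \<longlongrightarrow> l) at_top) \<or> filterlim b at_top at_top"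
    if b: "b \<in> K" "\<forall>\<^sub>F t in at_top. deriv b t \<ge> 0" for b
  proof -
    have "\<forall>\<^sub>F t in at_top. (b has_real_derivative deriv b t) (at t) \<and> deriv b t \<ge> 0"
      using has_deriv[OF b(1)] b(2) by eventually_elim auto
    then obtain T where T: "\<And>t. t \<ge> T \<Longrightarrow> (b has_real_derivative deriv b t) (at t) \<and> deriv b t \<ge> 0"
      unfolding eventually_at_top_linorder by blast
    show ?thesis
    proof (rule monotone_imp_limit_or_at_top)
      fix s t assume "T \<le> s" "s \<le> t"
      show "b s \<le> b t"
        by (rule DERIV_nonneg_imp_nondecreasing[OF \<open>s \<le> t\<close>]) (use T \<open>T \<le> s\<close> in \<open>meson order_trans\<close>)
    qed
  qed
  have "(\<forall>\<^sub>F t in at_top. deriv a t \<ge> 0) \<or> (\<forall>\<^sub>F t in at_top. deriv a t \<le> 0)"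
  proof -
    have "(\<forall>\<^sub>F t in at_top. deriv a t = 0) \<or> (\<forall>\<^sub>F t in at_top. deriv a t > 0)
        \<or> (\<forall>\<^sub>F t in at_top. deriv a t < 0)"
      using eventually_zero_or_nonzero[OF deriv_mem[OF assms]]
        eventually_signed[OF deriv_mem[OF assms]] by argo
    then show ?thesis
    proof (elim disjE)
      assume "\<forall>\<^sub>F t in at_top. deriv a t < 0"
      then show ?thesis by (intro disjI2) (auto elim: eventually_mono)
    qed (intro disjI1, auto elim: eventually_mono)+
  qed
  then show thesis
  proof
    assume "\<forall>\<^sub>F t in at_top. deriv a t \<ge> 0"
    from mono[OF assms this] show thesis using that(1,2) by (elim disjE exE)
  next
    assume neg: "\<forall>\<^sub>F t in at_top. deriv a t \<le> 0"
    have "\<forall>\<^sub>F t in at_top. deriv (\<lambda>t. - a t) t \<ge> 0"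
      using has_deriv[OF assms] neg
    proof eventually_elim
      case (elim t)
      from DERIV_imp_deriv[OF DERIV_minus[OF elim(1)]] elim(2) show ?case by simp
    qed
    from mono[OF uminus_mem[OF assms] this] show thesis
    proof
      assume "\<exists>l. ((\<lambda>t. - a t) \<longlongrightarrow> l) at_top"
      then obtain l where "((\<lambda>t. - a t) \<longlongrightarrow> l) at_top" ..
      from tendsto_minus[OF this] show thesis by (intro that(1)) simp
    next
      assume "filterlim (\<lambda>t. - a t) at_top at_top"
      then show thesis by (intro that(3)) (simp add: filterlim_uminus_at_top)
    qed
  qed
qed

text \<open>
  The quotient \<open>f' / g'\<close> lies in the field and therefore has a limit, possibly infinite; a limit other
  than \<open>x\<close> would eventually separate \<open>f' / g'\<close> from \<open>x\<close>, contrary to lemma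
  \<open>quotient_limit_ge\<close>.
  If \<open>g\<close> tends to a nonzero constant, the conclusion may fail, as for \<open>f = 1 / t\<^sup>2\<close> and
  \<open>g = 1 + 1 / t\<^sup>2\<close>.
\<close>

lemma converse_lhopital:
  assumes f: "f \<in> K" and g: "g \<in> K" and nz: "\<forall>\<^sub>F t in at_top. g t \<noteq> 0"
    and lim: "((\<lambda>t. f t / g t) \<longlongrightarrow> x) at_top"
    and no_const: "\<And>c. c \<noteq> 0 \<Longrightarrow> \<not> (g \<longlongrightarrow> c) at_top"
  shows "((\<lambda>t. deriv f t / deriv g t) \<longlongrightarrow> x) at_top" and "\<forall>\<^sub>F t in at_top. deriv g t \<noteq> 0"
proof -
  note df = has_deriv[OF f] and dg = has_deriv[OF g]
  show g': "\<forall>\<^sub>F t in at_top. deriv g t \<noteq> 0"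
  proof (rule ccontr)
    assume "\<not> ?thesis"
    then have "\<forall>\<^sub>F t in at_top. deriv g t = 0" using eventually_zero_or_nonzero[OF deriv_mem[OF g]] by blast
    then have "\<forall>\<^sub>F t in at_top. (g has_real_derivative 0) (at t) \<and> g t \<noteq> 0"
      using dg nz by eventually_elim auto
    then obtain T where T: "\<And>t. t \<ge> T \<Longrightarrow> (g has_real_derivative 0) (at t) \<and> g t \<noteq> 0"
      unfolding eventually_at_top_linorder by blast
    have "g t = g T" if "t \<ge> T" for t
    proof (rule antisym)
      show "g T \<le> g t" by (rule DERIV_nonneg_imp_nondecreasing[OF that]) (use T in \<open>meson order.refl\<close>)
      show "g t \<le> g T" by (rule DERIV_nonpos_imp_nonincreasing[OF that]) (use T in \<open>meson order.refl\<close>)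
    qed
    then have "\<forall>\<^sub>F t in at_top. g T = g t"
      unfolding eventually_at_top_linorder by metis
    from Lim_transform_eventually[OF tendsto_const this] no_const[of "g T"] T[of T] show False by auto
  qed
  have cases: "filterlim g at_infinity at_top \<or> (f \<longlongrightarrow> 0) at_top \<and> (g \<longlongrightarrow> 0) at_top"
  proof (cases rule: limit_cases[OF g, case_names real top bot])
    case (real l)
    with no_const[of l] have g0: "(g \<longlongrightarrow> 0) at_top" by (cases "l = 0") auto
    have "((\<lambda>t. f t / g t * g t) \<longlongrightarrow> 0) at_top" using tendsto_mult[OF lim g0] by simp
    then have "(f \<longlongrightarrow> 0) at_top"
      by (rule Lim_transform_eventually) (use nz in \<open>eventually_elim, simp\<close>)
    with g0 show ?thesis by blast
  qed (auto intro: filterlim_at_top_imp_at_infinity filterlim_at_bot_imp_at_infinity)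
  have lower: "c \<le> x" if "\<forall>\<^sub>F t in at_top. c \<le> deriv f t / deriv g t" for c
    by (rule quotient_limit_ge[OF df dg g' that nz lim cases])
  have upper: "x \<le> c" if c: "\<forall>\<^sub>F t in at_top. deriv f t / deriv g t \<le> c" for c
  proof -
    have df': "\<forall>\<^sub>F t in at_top. ((\<lambda>t. - f t) has_real_derivative - deriv f t) (at t)"
      using df by eventually_elim (rule DERIV_minus)
    have "\<forall>\<^sub>F t in at_top. - c \<le> - deriv f t / deriv g t" using c by eventually_elim auto
    moreover have "((\<lambda>t. - f t / g t) \<longlongrightarrow> - x) at_top" using tendsto_minus[OF lim] by simp
    moreover have "filterlim g at_infinity at_top \<or> ((\<lambda>t. - f t) \<longlongrightarrow> 0) at_top \<and> (g \<longlongrightarrow> 0) at_top"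
      using cases tendsto_minus[of f 0] by auto
    ultimately have "- c \<le> - x" by (rule quotient_limit_ge[OF df' dg g' _ nz])
    then show ?thesis by simp
  qed
  show "((\<lambda>t. deriv f t / deriv g t) \<longlongrightarrow> x) at_top"
  proof (cases rule: limit_cases[OF divide_mem[OF deriv_mem[OF f] deriv_mem[OF g]], case_names real top bot])
    case (real l)
    have "\<not> l < x"
    proof
      assume "l < x"
      then have "\<forall>\<^sub>F t in at_top. deriv f t / deriv g t < (l + x) / 2"
        by (intro order_tendstoD(2)[OF real]) auto
      then have "x \<le> (l + x) / 2" by (intro upper) (auto elim: eventually_mono)
      with \<open>l < x\<close> show False by simp
    qed
    moreover have "\<not> x < l"
    proof
      assume "x < l"
      then have "\<forall>\<^sub>F t in at_top. (l + x) / 2 < deriv f t / deriv g t"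
        by (intro order_tendstoD(1)[OF real]) auto
      then have "(l + x) / 2 \<le> x" by (intro lower) (auto elim: eventually_mono)
      with \<open>x < l\<close> show False by simp
    qed
    ultimately show ?thesis using real by (cases x l rule: linorder_cases) auto
  next
    case top
    then have "x + 1 \<le> x" by (intro lower) (auto simp: filterlim_at_top)
    then show ?thesis by simp
  next
    case bot
    then have "x \<le> x - 1" by (intro upper) (auto simp: filterlim_at_bot)
    then show ?thesis by simp
  qed
qed

end

section \<open>Derivatives and Taylor approximation\<close>

text \<open>
  Derivatives of a strongly nonpolynomial function need not be strongly nonpolynomial, since they may
  tend to \<open>0\<close>. This weaker property is stable under differentiation and still excludes nonzero
  finite limits of the function and of all its derivatives.
\<close>

definition avoids_monomials :: "(real \<Rightarrow> real) \<Rightarrow> bool" where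
  "avoids_monomials f \<longleftrightarrow> (\<forall>(e::nat) c. c \<noteq> 0 \<longrightarrow> \<not> ((\<lambda>t. f t / t ^ e) \<longlongrightarrow> c) at_top)"

lemma avoids_monomials_no_limit:
  assumes "avoids_monomials f" "c \<noteq> 0" shows "\<not> (f \<longlongrightarrow> c) at_top"
  using assms(1)[unfolded avoids_monomials_def, rule_format, of c 0] assms(2) by simp

lemma power_bigo_power:
  assumes "m \<le> n" shows "(\<lambda>t::real. t ^ m) \<in> O[at_top](\<lambda>t. t ^ n)"
proof (rule bigoI[where c = 1])
  show "\<forall>\<^sub>F t::real in at_top. norm (t ^ m) \<le> 1 * norm (t ^ n)"
    using eventually_ge_at_top[of 1]
    by eventually_elim (use assms in \<open>simp add: power_increasing\<close>)
qed

lemma strongly_nonpolynomial_imp_avoids_monomials: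
  assumes "strongly_nonpolynomial f" shows "avoids_monomials f"
  unfolding avoids_monomials_def
proof (intro allI impI notI)
  fix k :: nat and c :: real
  assume c: "c \<noteq> 0" and lim: "((\<lambda>t. f t / t ^ k) \<longlongrightarrow> c) at_top"
  from assms obtain e where e: "(\<lambda>t. t ^ e) \<in> o[at_top](f)" "f \<in> o[at_top](\<lambda>t. t ^ (e + 1))"
    unfolding strongly_nonpolynomial_def by blast
  have nz: "\<forall>\<^sub>F t::real in at_top. t ^ n \<noteq> 0" for n
    using eventually_gt_at_top[of 0] by eventually_elim simp
  have th: "f \<in> \<Theta>[at_top](\<lambda>t. t ^ k)"
    by (rule bigthetaI_tendsto[OF c lim]) 
  then have o: "f \<in> O[at_top](\<lambda>t. t ^ k)" "(\<lambda>t. t ^ k) \<in> O[at_top](f)"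
    by (auto simp: bigtheta_def bigomega_iff_bigo)
  obtain n where "\<forall>\<^sub>F t::real in at_top. t ^ n = 0"
  proof (cases "k \<le> e")
    case True
    from landau_o.big_trans[OF o(1) power_bigo_power[OF True]] e(1)
    have "\<forall>\<^sub>F t::real in at_top. t ^ e = 0" by (metis landau_o.small_big_asymmetric)
    then show thesis by (rule that)
  next
    case False
    then have "e + 1 \<le> k" by simp
    from landau_o.big_trans[OF power_bigo_power[OF this] o(2)] e(2)
    have "\<forall>\<^sub>F t::real in at_top. t ^ (e + 1) = 0" by (rule landau_o.big_small_asymmetric)
    then show thesis by (rule that)
  qed
  with nz[of n] have "\<forall>\<^sub>F t::real in at_top. False" by eventually_elim simp
  then show False by simp
qed

context hardy begin

text \<open>
  If \<open>f'\<close> is asymptotic to \<open>c t\<^sup>e\<close>, then \<open>f\<close> is asymptotic to \<open>c t\<^sup>e\<^sup>+\<^sup>1 / (e + 1)\<close> by l'Hopital's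
  rule.
\<close>

lemma avoids_monomials_deriv:
  assumes "f \<in> K" "avoids_monomials f"
  shows "avoids_monomials (deriv f)"
  unfolding avoids_monomials_def
proof (intro allI impI notI)
  fix e :: nat and c :: real
  assume c: "c \<noteq> 0" and lim: "((\<lambda>t. deriv f t / t ^ e) \<longlongrightarrow> c) at_top"
  have "((\<lambda>t. f t / t ^ (e + 1)) \<longlongrightarrow> c / (e + 1)) at_top"
  proof (rule lhospital_at_top_at_top)
    show "filterlim (\<lambda>t::real. t ^ (e + 1)) at_top at_top"
      by (intro filterlim_pow_at_top filterlim_ident) auto
    show "\<forall>\<^sub>F t in at_top. real (e + 1) * t ^ e \<noteq> 0"
      using eventually_gt_at_top[of 0] by eventually_elim simp
    show "\<forall>\<^sub>F t in at_top. (f has_real_derivative deriv f t) (at t)" by (rule has_deriv[OF assms(1)])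
    show "\<forall>\<^sub>F t in at_top. ((\<lambda>t::real. t ^ (e + 1)) has_real_derivative real (e + 1) * t ^ e) (at t)"
      using DERIV_pow[of "e + 1"] by (intro always_eventually allI) simp
    show "((\<lambda>t. deriv f t / (real (e + 1) * t ^ e)) \<longlongrightarrow> c / (e + 1)) at_top"
      using tendsto_divide[OF lim tendsto_const, of "real (e + 1)"] by (simp add: mult.commute)
  qed
  with assms(2) c show False
    unfolding avoids_monomials_def by (metis divide_eq_0_iff of_nat_0_eq_iff add_eq_0_iff_both_eq_0 zero_neq_one)
qed

lemma avoids_monomials_higher_deriv:
  assumes "f \<in> K" "avoids_monomials f"
  shows "(deriv ^^ k) f \<in> K \<and> avoids_monomials ((deriv ^^ k) f)"
  by (induction k) (auto intro: assms deriv_mem avoids_monomials_deriv)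

lemma higher_deriv_mem: "f \<in> K \<Longrightarrow> (deriv ^^ k) f \<in> K"
  by (induction k) (auto intro: deriv_mem)

lemma deriv_smallo:
  assumes "f \<in> K" "g \<in> K" "avoids_monomials g" "\<forall>\<^sub>F t in at_top. g t \<noteq> 0" "f \<in> o[at_top](g)"
  shows "deriv f \<in> o[at_top](deriv g)" "\<forall>\<^sub>F t in at_top. deriv g t \<noteq> 0"
proof -
  have *: "((\<lambda>t. deriv f t / deriv g t) \<longlongrightarrow> 0) at_top" "\<forall>\<^sub>F t in at_top. deriv g t \<noteq> 0"
    using converse_lhopital[OF assms(1,2,4) smalloD_tendsto[OF assms(5)]]
      avoids_monomials_no_limit[OF assms(3)] by blast+
  show "\<forall>\<^sub>F t in at_top. deriv g t \<noteq> 0" by (rule *(2))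
  with *(1) show "deriv f \<in> o[at_top](deriv g)" by (intro smalloI_tendsto)
qed

lemma higher_deriv_smallo:
  assumes "f \<in> K" "g \<in> K" "avoids_monomials g" "\<forall>\<^sub>F t in at_top. g t \<noteq> 0" "f \<in> o[at_top](g)"
  shows "(deriv ^^ k) f \<in> o[at_top]((deriv ^^ k) g)"
proof -
  have "(deriv ^^ k) f \<in> o[at_top]((deriv ^^ k) g) \<and> (\<forall>\<^sub>F t in at_top. (deriv ^^ k) g t \<noteq> 0)"
  proof (induction k)
    case 0
    with assms show ?case by simp
  next
    case (Suc k)
    then show ?case
      using deriv_smallo[of "(deriv ^^ k) f" "(deriv ^^ k) g"] assms
        avoids_monomials_higher_deriv higher_deriv_mem by simp
  qed
  then show ?thesis ..
qed

text \<open>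
  Lagrange's form of the remainder, with the intermediate value of the derivative bounded by its value
  at \<open>N\<close>.
\<close>

lemma taylor_error_tendsto_0:
  assumes f: "f \<in> K" and u: "has_fracdeg ((deriv ^^ Suc k) f) a" "a < 0"
    and L: "filterlim L at_top at_top"
    and lim: "((\<lambda>t. \<bar>(deriv ^^ Suc k) f t\<bar> * L t ^ Suc k) \<longlongrightarrow> 0) at_top"
  shows "(\<lambda>N::nat. MAX n\<in>{n::nat. 1 \<le> n \<and> real n \<le> L (real N)}.
           \<bar>f (real N + real n) - taylor_approx f k (real N) (real n)\<bar>) \<longlonglongrightarrow> 0"
    (is "(\<lambda>N. Max (?e N ` ?S N)) \<longlonglongrightarrow> 0")
proof -
  let ?u = "(deriv ^^ Suc k) f"
  obtain T1 where T1: "\<And>s t. T1 \<le> s \<Longrightarrow> s \<le> t \<Longrightarrow> \<bar>?u t\<bar> \<le> \<bar>?u s\<bar>"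
    using has_fracdeg_neg_imp_abs_decreasing[OF u] by blast
  have "\<forall>\<^sub>F t in at_top. \<forall>m\<in>{..k}. ((deriv ^^ m) f has_real_derivative (deriv ^^ Suc m) f t) (at t)"
    using has_deriv[OF higher_deriv_mem[OF f]] by (intro eventually_ball_finite) auto
  then obtain T2 where T2: "\<And>t m. t \<ge> T2 \<Longrightarrow> m \<le> k \<Longrightarrow>
      ((deriv ^^ m) f has_real_derivative (deriv ^^ Suc m) f t) (at t)"
    unfolding eventually_at_top_linorder by (meson atMost_iff)
  have bound: "?e N n \<le> \<bar>?u (real N)\<bar> * L (real N) ^ Suc k"
    if N: "real N \<ge> max T1 T2" and n: "n \<in> ?S N" for N n
  proof -
    obtain t where t: "real N < t" "t < real N + real n"
      "f (real N + real n) = (\<Sum>m<Suc k. (deriv ^^ m) f (real N) / fact m * (real N + real n - real N) ^ m)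
        + ?u t / fact (Suc k) * (real N + real n - real N) ^ Suc k"
      using Taylor_up[of "Suc k" "\<lambda>m. (deriv ^^ m) f" f "real N" "real N + real n" "real N"] T2 N n
      by (auto simp: less_Suc_eq_le)
    then have "?e N n = \<bar>?u t\<bar> / fact (Suc k) * real n ^ Suc k"
      by (simp add: taylor_approx_def atLeast0AtMost lessThan_Suc_atMost abs_mult del: fact_Suc power_Suc sum.lessThan_Suc funpow.simps)
    also have "\<dots> \<le> \<bar>?u t\<bar> * real n ^ Suc k"
      using fact_ge_1[of "Suc k", where ?'a = real]
      by (intro mult_right_mono) (auto simp: divide_le_eq mult_le_cancel_left1 simp del: fact_Suc funpow.simps)
    also have "\<dots> \<le> \<bar>?u (real N)\<bar> * L (real N) ^ Suc k"
      using n N t by (intro mult_mono T1 power_mono) auto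
    finally show ?thesis .
  qed
  have fin: "finite (?S N)" for N
    by (rule finite_subset[of _ "{..nat \<lfloor>L (real N)\<rfloor>}"]) (auto simp: le_nat_floor)
  have lim': "(\<lambda>N. \<bar>?u (real N)\<bar> * L (real N) ^ Suc k) \<longlonglongrightarrow> 0"
    by (rule filterlim_compose[OF lim filterlim_real_sequentially])
  have "\<forall>\<^sub>F t in at_top. L t \<ge> 1" using L by (simp add: filterlim_at_top)
  then have L1: "\<forall>\<^sub>F N in sequentially. L (real N) \<ge> 1"
    by (rule eventually_compose_filterlim[OF _ filterlim_real_sequentially])
  have ev: "\<forall>\<^sub>F N in sequentially. real N \<ge> max T1 T2"
    by (rule eventually_compose_filterlim[OF eventually_ge_at_top filterlim_real_sequentially])
  show ?thesis
  proof (rule tendsto_sandwich[OF _ _ tendsto_const lim'])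
    show "\<forall>\<^sub>F N in sequentially. 0 \<le> Max (?e N ` ?S N)"
      using L1
    proof eventually_elim
      case (elim N)
      then have "1 \<in> ?S N" by simp
      from Max_ge[OF finite_imageI[OF fin] imageI[OF this, of "?e N"]]
      show ?case by (rule order_trans[rotated]) simp
    qed
    show "\<forall>\<^sub>F N in sequentially. Max (?e N ` ?S N) \<le> \<bar>?u (real N)\<bar> * L (real N) ^ Suc k"
      using L1 ev
    proof eventually_elim
      case (elim N)
      then have "1 \<in> ?S N" by simp
      then have "?S N \<noteq> {}" by blast
      then show ?case using fin bound[OF elim(2)] by (intro Max.boundedI) auto
    qed
  qed
qed

end

locale hardy_ident = hardy +
  assumes ident_mem: "(\<lambda>t. t) \<in> K"
begin

text \<open>
  The converse of l'Hopital's rule for \<open>t f' / f\<close> shows that \<open>(t f')' / f' = 1 + t f'' / f'\<close> tends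
  to \<open>a\<close>.
\<close>

lemma has_fracdeg_deriv:
  assumes f: "f \<in> K" "avoids_monomials f" "has_fracdeg f a"
  shows "has_fracdeg (deriv f) (a - 1)"
proof (rule has_fracdegI[where f' = "deriv (deriv f)"])
  let ?h = "\<lambda>t. t * deriv f t"
  have h: "?h \<in> K" by (intro mult_mem ident_mem deriv_mem f)
  have *: "((\<lambda>t. deriv ?h t / deriv f t) \<longlongrightarrow> a) at_top" "\<forall>\<^sub>F t in at_top. deriv f t \<noteq> 0"
    using converse_lhopital[OF h f(1) has_fracdegD(2,3)[OF f(3)]] avoids_monomials_no_limit[OF f(2)]
    by blast+
  note d2 = has_deriv[OF deriv_mem[OF f(1)]]
  show "\<forall>\<^sub>F t in at_top. (deriv f has_real_derivative deriv (deriv f) t) (at t) \<and> deriv f t \<noteq> 0"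
    using d2 *(2) by eventually_elim simp
  have "((\<lambda>t. deriv ?h t / deriv f t - 1) \<longlongrightarrow> a - 1) at_top" by (intro tendsto_intros *(1))
  moreover have "\<forall>\<^sub>F t in at_top. deriv ?h t / deriv f t - 1 = t * deriv (deriv f) t / deriv f t"
    using d2 *(2)
  proof eventually_elim
    case (elim t)
    have "(?h has_real_derivative deriv f t + t * deriv (deriv f) t) (at t)"
      using elim(1) by (auto intro!: derivative_eq_intros)
    from DERIV_imp_deriv[OF this] elim(2) show ?case by (simp add: field_simps)
  qed
  ultimately show "((\<lambda>t. t * deriv (deriv f) t / deriv f t) \<longlongrightarrow> a - 1) at_top"
    by (rule Lim_transform_eventually)
qed

lemma has_fracdeg_higher_deriv:
  assumes "f \<in> K" "avoids_monomials f" "has_fracdeg f a"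
  shows "has_fracdeg ((deriv ^^ k) f) (a - real k)"
proof (induction k)
  case 0
  with assms show ?case by simp
next
  case (Suc k)
  with has_fracdeg_deriv[OF _ _ Suc] avoids_monomials_higher_deriv[OF assms(1,2), of k]
  show ?case by (simp add: algebra_simps)
qed

text \<open>
  An infinite limit of \<open>t f' / f\<close> would make \<open>f\<close> larger, or smaller, than every power of \<open>t\<close>.
\<close>

lemma fracdeg_exists:
  assumes f: "f \<in> K" and lower: "(\<lambda>t. t powr c) \<in> O[at_top](f)" and upper: "f \<in> O[at_top](\<lambda>t. t powr d)"
  shows "has_fracdeg f (fracdeg f)"
proof -
  have powr_nz: "\<not> (\<forall>\<^sub>F t in at_top. t powr b = 0)" for b :: real
  proof
    assume "\<forall>\<^sub>F t in at_top. t powr b = 0"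
    with eventually_gt_at_top[of 0] have "\<forall>\<^sub>F t::real in at_top. False" by eventually_elim simp
    then show False by simp
  qed
  have steep: "\<not> (\<lambda>t. t powr s) \<in> O[at_top](\<lambda>t. t powr r)" if "r < s" for r s :: real
  proof
    assume "(\<lambda>t. t powr s) \<in> O[at_top](\<lambda>t. t powr r)"
    from landau_o.big_small_asymmetric[OF this has_fracdeg_less_imp_smallo[OF has_fracdeg_powr has_fracdeg_powr that]]
      powr_nz show False by blast
  qed
  have nz: "\<forall>\<^sub>F t in at_top. f t \<noteq> 0"
  proof (rule ccontr)
    assume "\<not> ?thesis"
    with eventually_zero_or_nonzero[OF f] have "\<forall>\<^sub>F t in at_top. f t = 0" by blast
    then have "f \<in> o[at_top](\<lambda>t. t powr c)"
      by (intro landau_o.smallI) (auto elim!: eventually_mono)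
    from landau_o.big_small_asymmetric[OF lower this]
    have "\<forall>\<^sub>F t in at_top. t powr c = 0" .
    with powr_nz show False by blast
  qed
  note df = has_deriv[OF f]
  have "(\<lambda>t. t * deriv f t / f t) \<in> K" by (intro divide_mem mult_mem ident_mem deriv_mem f)
  then show ?thesis
  proof (cases rule: limit_cases)
    case (1 l)
    have "has_fracdeg f l"
      by (rule has_fracdegI[OF _ 1]) (use df nz in eventually_elim, simp)
    with has_fracdegD(4)[OF this] show ?thesis by simp
  next
    case 2
    then have "\<forall>\<^sub>F t in at_top. d + 1 \<le> t * deriv f t / f t" by (simp add: filterlim_at_top)
    from power_lower_bound[OF df nz this] obtain C where
      C: "C > 0" "\<forall>\<^sub>F t in at_top. C * t powr (d + 1) \<le> \<bar>f t\<bar>" by blast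
    have "(\<lambda>t. t powr (d + 1)) \<in> O[at_top](f)"
      by (rule bigoI[where c = "1 / C"]) (use C in \<open>auto elim!: eventually_mono simp: field_simps\<close>)
    from landau_o.big_trans[OF this upper] steep[of d "d + 1"] show ?thesis by simp
  next
    case 3
    \<comment> \<open>the reciprocal grows faster than every power\<close>
    let ?g = "\<lambda>t. inverse (f t)"
    have dg: "\<forall>\<^sub>F t in at_top. (?g has_real_derivative - deriv f t / (f t)\<^sup>2) (at t)"
      using df nz by eventually_elim (auto intro!: derivative_eq_intros simp: power2_eq_square field_simps)
    then have dg': "\<forall>\<^sub>F t in at_top. (?g has_real_derivative deriv ?g t) (at t)"
      by eventually_elim (simp add: DERIV_imp_deriv)
    have "\<forall>\<^sub>F t in at_top. t * deriv f t / f t \<le> c - 1" using 3 by (simp add: filterlim_at_bot)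
    with dg nz have le: "\<forall>\<^sub>F t in at_top. 1 - c \<le> t * deriv ?g t / ?g t"
    proof eventually_elim
      case (elim t)
      then have "t * deriv ?g t / ?g t = - (t * deriv f t / f t)"
        by (simp add: DERIV_imp_deriv power2_eq_square)
      with elim(3) show ?case by simp
    qed
    have "\<forall>\<^sub>F t in at_top. ?g t \<noteq> 0" using nz by eventually_elim simp
    from power_lower_bound[OF dg' this le] obtain C where
      C: "C > 0" "\<forall>\<^sub>F t in at_top. C * t powr (1 - c) \<le> \<bar>?g t\<bar>" by blast
    have "\<forall>\<^sub>F t in at_top. norm (f t) \<le> (1 / C) * norm (t powr (c - 1))"
      using C(2) nz eventually_gt_at_top[of 0]
    proof eventually_elim
      case (elim t)
      have "t powr (c - 1) = inverse (t powr (1 - c))" by (simp flip: powr_minus)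
      then show ?case using elim C(1) by (simp only:) (simp add: field_simps)
    qed
    then have "f \<in> O[at_top](\<lambda>t. t powr (c - 1))" by (rule bigoI)
    from landau_o.big_trans[OF lower this] steep[of "c - 1" c] show ?thesis by simp
  qed
qed

end

section \<open>Rational powers\<close>

text \<open>
  The identity is the composition of an unbounded element, or its negative, with its inverse.
\<close>

lemma (in hardy) ident_mem_if_unbounded:
  assumes "closed_under_composition K" "closed_under_inversion K"
    and a: "a \<in> K" "filterlim a at_infinity at_top"
  shows "(\<lambda>t. t) \<in> K"
proof -
  obtain b where b: "b \<in> K" "filterlim b at_top at_top"
  proof (cases rule: limit_cases[OF a(1), case_names real top bot])
    case (real l)
    with a(2) have False by (metis not_tendsto_and_filterlim_at_infinity trivial_limit_at_top_linorder)
    then show ?thesis ..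
  next
    case top
    with a(1) that show ?thesis by blast
  next
    case bot
    then have "filterlim (\<lambda>t. - a t) at_top at_top" by (simp add: filterlim_uminus_at_bot)
    with uminus_mem[OF a(1)] that show ?thesis by blast
  qed
  with assms(2) obtain c where c: "c \<in> K" "\<forall>\<^sub>F t in at_top. b (c t) = t \<and> c (b t) = t"
    unfolding closed_under_inversion_def by blast
  have "c \<circ> b \<in> K" using assms(1) b c(1) unfolding closed_under_composition_def by blast
  then show ?thesis by (rule cong_mem) (use c(2) in eventually_elim, simp)
qed

locale hardy_closed = hardy_ident +
  assumes comp: "closed_under_composition K" and inversion: "closed_under_inversion K"
begin

text \<open>
  The compositional inverse of \<open>t\<^sup>n\<close> is the \<open>n\<close>-th root.
\<close>

lemma root_mem:
  assumes "n > 0" shows "(\<lambda>t. t powr (1 / real n)) \<in> K"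
proof -
  have "(\<lambda>t. t ^ n) \<in> K" by (intro power_mem ident_mem)
  moreover have "filterlim (\<lambda>t::real. t ^ n) at_top at_top"
    using assms by (intro filterlim_pow_at_top filterlim_ident)
  ultimately obtain b where b: "b \<in> K" "\<forall>\<^sub>F t in at_top. b t ^ n = t \<and> b (t ^ n) = t"
    using inversion unfolding closed_under_inversion_def by blast
  have "\<forall>\<^sub>F t in at_top. b ((t powr (1 / real n)) ^ n) = t powr (1 / real n)"
    by (rule eventually_compose_filterlim[OF _ powr_at_top]) (use b(2) assms in \<open>auto elim: eventually_mono\<close>)
  with eventually_gt_at_top[of 0] have "\<forall>\<^sub>F t in at_top. b t = t powr (1 / real n)"
  proof eventually_elim
    case (elim t)
    have "(t powr (1 / real n)) ^ n = t"
      using elim(1) assms by (simp add: powr_powr flip: powr_realpow)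
    with elim(2) show ?case by simp
  qed
  with b(1) show ?thesis by (rule cong_mem)
qed

lemma rational_powr_mem:
  assumes "r \<in> \<rat>" shows "(\<lambda>t. t powr r) \<in> K"
proof -
  have pos: "(\<lambda>t. t powr (real k / real n)) \<in> K" if "n > 0" for k n :: nat
  proof (rule cong_mem[OF power_mem[OF root_mem[OF that]]])
    show "\<forall>\<^sub>F t in at_top. (t powr (1 / real n)) ^ k = t powr (real k / real n)"
      using eventually_gt_at_top[of 0]
      by eventually_elim (simp add: powr_powr flip: powr_realpow)
  qed
  from assms obtain k n :: nat where kn: "n > 0" "\<bar>r\<bar> = real k / real n"
    by (metis Rats_abs_nat_div_natE gr0I)
  show ?thesis
  proof (cases "r \<ge> 0")
    case True
    with pos[OF kn(1), of k] kn(2) show ?thesis by simp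
  next
    case False
    then have "r = - (real k / real n)" using kn(2) by simp
    with inverse_mem[OF pos[OF kn(1), of k]] show ?thesis by (simp add: powr_minus)
  qed
qed

lemma abs_mem:
  assumes "f \<in> K" shows "(\<lambda>t. \<bar>f t\<bar>) \<in> K"
proof (cases "\<forall>\<^sub>F t in at_top. f t \<ge> 0")
  case True
  then show ?thesis by (intro cong_mem[OF assms]) (auto elim: eventually_mono)
next
  case False
  have "\<forall>\<^sub>F t in at_top. f t < 0"
    using eventually_zero_or_nonzero[OF assms] eventually_signed[OF assms] False
      eventually_mono[of "\<lambda>t. f t = 0" at_top "\<lambda>t. f t \<ge> 0"]
      eventually_mono[of "\<lambda>t. f t > 0" at_top "\<lambda>t. f t \<ge> 0"]
    by fastforce
  then show ?thesis by (intro cong_mem[OF uminus_mem[OF assms]]) (auto elim: eventually_mono)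
qed

text \<open>
  Composition with \<open>t powr r\<close> requires a function tending to infinity. If \<open>\<bar>f\<bar>\<close> is bounded, then
  \<open>t / \<bar>f\<bar>\<close> is such a function.
\<close>

lemma rational_abs_powr_mem:
  assumes f: "f \<in> K" and nz: "\<forall>\<^sub>F t in at_top. f t \<noteq> 0" and r: "r \<in> \<rat>"
  shows "(\<lambda>t. \<bar>f t\<bar> powr r) \<in> K"
proof -
  have unbdd: "(\<lambda>t. p t powr s) \<in> K" if p: "p \<in> K" "filterlim p at_top at_top" and "s \<in> \<rat>" for p s
  proof -
    have "(\<lambda>t. t powr s) \<circ> p \<in> K"
      using comp p rational_powr_mem[OF \<open>s \<in> \<rat>\<close>] unfolding closed_under_composition_def by blast
    then show ?thesis by (simp add: o_def)
  qed
  show ?thesis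
  proof (cases rule: limit_cases[OF abs_mem[OF f], case_names real top bot])
    case (real l)
    have "filterlim (\<lambda>t. t / \<bar>f t\<bar>) at_top at_top"
    proof (rule filterlim_at_top_mono)
      have "l \<ge> 0" by (rule tendsto_lowerbound[OF real]) auto
      then show "filterlim (\<lambda>t. 1 / (l + 1) * t) at_top at_top"
        by (intro filterlim_tendsto_pos_mult_at_top[OF tendsto_const] filterlim_ident) auto
      have "\<forall>\<^sub>F t in at_top. \<bar>f t\<bar> < l + 1" by (rule order_tendstoD(2)[OF real]) simp
      with nz eventually_gt_at_top[of 0] show "\<forall>\<^sub>F t in at_top. 1 / (l + 1) * t \<le> t / \<bar>f t\<bar>"
        by eventually_elim (auto simp: frac_le)
    qed
    from unbdd[OF divide_mem[OF ident_mem abs_mem[OF f]] this, of "- r"] r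
    have "(\<lambda>t. t powr r * (t / \<bar>f t\<bar>) powr - r) \<in> K"
      by (intro mult_mem rational_powr_mem) auto
    then show ?thesis
    proof (rule cong_mem)
      show "\<forall>\<^sub>F t in at_top. t powr r * (t / \<bar>f t\<bar>) powr - r = \<bar>f t\<bar> powr r"
        using nz eventually_gt_at_top[of 0]
        by eventually_elim (simp add: powr_divide powr_minus field_simps)
    qed
  next
    case top
    with unbdd[OF abs_mem[OF f] top r] show ?thesis by simp
  next
    case bot
    then have "\<forall>\<^sub>F t in at_top. \<bar>f t\<bar> \<le> - 1" by (simp add: filterlim_at_bot)
    then have "\<forall>\<^sub>F t::real in at_top. False" by eventually_elim simp
    then show ?thesis by simp
  qed
qed

lemma poly_growth_partI:
  assumes "f \<in> K" "has_fracdeg f a"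
  shows "f \<in> poly_growth_part K"
proof -
  have "f \<in> o[at_top](\<lambda>t. t powr (\<bar>a\<bar> + 1))"
    by (rule has_fracdeg_less_imp_smallo[OF assms(2) has_fracdeg_powr]) simp
  from landau_o.small_imp_big[OF this] assms(1) show ?thesis
    unfolding poly_growth_part_def by (intro CollectI conjI exI[of _ "\<bar>a\<bar> + 1"]) auto
qed

end

lemma has_fracdeg_deriv_scale:
  assumes "has_fracdeg ((deriv ^^ k) f) (a - real k)" "k > 0"
  shows "has_fracdeg (deriv_scale f k) (1 - a / real k)"
proof -
  have "- 1 / real k * (a - real k) = 1 - a / real k" using assms(2) by (simp add: field_simps)
  with has_fracdeg_abs_powr[OF assms(1), of "- 1 / real k"] show ?thesis
    unfolding deriv_scale_def[abs_def] by simp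
qed

section \<open>The choice of the Taylor degrees\<close>

text \<open>
  If \<open>Q r\<close> is an integer for some \<open>Q > 0\<close>, then \<open>(1 + k Q) r\<close> differs from \<open>r\<close> by an integer. If there
  is no such \<open>Q\<close>, no positive multiple of \<open>r\<close> is an integer. So all numbers that are \<open>1\<close> modulo the
  product of the numbers \<open>Q\<close> will do.
\<close>

lemma nonintegral_multiples_exist:
  fixes S :: "real set"
  assumes "finite S" "\<And>r. r \<in> S \<Longrightarrow> r \<notin> \<int>"
  shows "\<exists>M\<ge>B. \<forall>r\<in>S. real M * r \<notin> \<int>"
proof -
  have "\<exists>P>0. \<forall>r\<in>S. \<forall>k. real (1 + k * P) * r \<notin> \<int>"
    using assms
  proof (induction S rule: finite_induct)
    case empty
    show ?case by (intro exI[of _ 1]) auto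
  next
    case (insert r S)
    then obtain P where P: "P > 0" "\<And>s k. s \<in> S \<Longrightarrow> real (1 + k * P) * s \<notin> \<int>" by auto
    obtain Q :: nat where Q: "Q > 0" "\<And>k. real (1 + k * Q) * r \<notin> \<int>"
    proof (cases "\<exists>Q>0::nat. real Q * r \<in> \<int>")
      case True
      then obtain Q :: nat where Q: "Q > 0" "real Q * r \<in> \<int>" by blast
      have "real (1 + k * Q) * r \<notin> \<int>" for k
      proof
        assume "real (1 + k * Q) * r \<in> \<int>"
        moreover have "real k * (real Q * r) \<in> \<int>" by (intro Ints_mult Q(2)) auto
        ultimately have "real (1 + k * Q) * r - real k * (real Q * r) \<in> \<int>" by (rule Ints_diff)
        then have "r \<in> \<int>" by (simp add: algebra_simps)
        with insert.prems show False by blast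
      qed
      with Q(1) that show thesis by blast
    next
      case False
      then have "real (1 + k * 1) * r \<notin> \<int>" for k by (metis add_gr_0 zero_less_one)
      from that[OF zero_less_one this] show thesis .
    qed
    show ?case
    proof (intro exI[of _ "P * Q"] conjI ballI allI)
      show "P * Q > 0" using P(1) Q(1) by simp
      fix s k assume "s \<in> insert r S"
      then show "real (1 + k * (P * Q)) * s \<notin> \<int>"
        using P(2)[of s "k * Q"] Q(2)[of "k * P"] by (auto simp: mult_ac)
    qed
  qed
  then obtain P where P: "P > 0" "\<And>r k. r \<in> S \<Longrightarrow> real (1 + k * P) * r \<notin> \<int>" by blast
  have "B * 1 \<le> B * P" using P(1) by (intro mult_le_mono) auto
  then have "B \<le> 1 + B * P" by linarith
  with P(2) show ?thesis by blast
qed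

text \<open>
  The set \<open>A\<close> consists of the positive fractional degrees, with largest element \<open>\<alpha>\<close>, and \<open>D a\<close> is the
  integer part of \<open>M a / \<alpha>\<close>. The slope \<open>\<alpha> / D \<alpha>\<close> is then \<open>\<alpha> / M\<close>, and its comparison with \<open>a / D a\<close> and
  \<open>a / (D a + 1)\<close> is the comparison of \<open>M a / \<alpha>\<close> with the two integers next to it.
\<close>

lemma taylor_degrees_exist:
  fixes A :: "real set"
  assumes fin: "finite A" and \<alpha>: "\<alpha> \<in> A" and A: "\<And>a. a \<in> A \<Longrightarrow> 0 < a \<and> a \<le> \<alpha>"
  obtains D :: "real \<Rightarrow> nat" where "inj_on D A" "\<alpha> < D \<alpha>"
    "\<And>a. a \<in> A \<Longrightarrow> q \<le> D a \<and> 0 < D a"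
    "\<And>a. a \<in> A \<Longrightarrow> a / (D a + 1) < \<alpha> / D \<alpha>"
    "\<And>a. a \<in> A \<Longrightarrow> \<alpha> / D \<alpha> \<le> a / D a"
    "\<And>a. a \<in> A \<Longrightarrow> \<alpha> / D \<alpha> = a / D a \<Longrightarrow> a = \<alpha>"
proof -
  have a0: "\<alpha> > 0" using A[OF \<alpha>] by simp
  have large: "\<forall>\<^sub>F M in sequentially. c \<le> real M * r" if "r > 0" for r c :: real
    using filterlim_at_top_mult_tendsto_pos[OF tendsto_const that filterlim_real_sequentially]
    by (auto simp: filterlim_at_top)
  \<comment> \<open>three requirements on \<open>M\<close>: each \<open>D a\<close> exceeds \<open>q\<close>, distinct degrees get distinct integer
    parts, and the slope \<open>\<alpha> / M\<close> is less than \<open>1\<close>\<close>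
  have multiple: "\<forall>\<^sub>F M in sequentially. real (Suc q) \<le> real M * (a / \<alpha>)" if "a \<in> A" for a
    using A[OF that] a0 by (intro large) simp
  have gap: "\<forall>\<^sub>F M in sequentially. a < b \<longrightarrow> 1 \<le> real M * ((b - a) / \<alpha>)" for a b
    using large[of "(b - a) / \<alpha>" 1] a0 by (cases "a < b") simp_all
  have "\<forall>\<^sub>F M in sequentially. (\<forall>a\<in>A. real (Suc q) \<le> real M * (a / \<alpha>)) \<and>
      (\<forall>a\<in>A. \<forall>b\<in>A. a < b \<longrightarrow> 1 \<le> real M * ((b - a) / \<alpha>)) \<and> \<alpha> + 1 \<le> real M * 1"
    by (intro eventually_conj eventually_ball_finite ballI fin multiple gap large) simp_all
  then obtain B where B: "\<And>M. M \<ge> B \<Longrightarrow> (\<forall>a\<in>A. real (Suc q) \<le> real M * (a / \<alpha>)) \<and>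
      (\<forall>a\<in>A. \<forall>b\<in>A. a < b \<longrightarrow> 1 \<le> real M * ((b - a) / \<alpha>)) \<and> \<alpha> + 1 \<le> real M * 1"
    unfolding eventually_sequentially by blast
  have nonint: "r \<notin> \<int>" if r: "r \<in> (\<lambda>a. a / \<alpha>) ` (A - {\<alpha>})" for r
  proof
    assume "r \<in> \<int>"
    then obtain k where k: "r = of_int k" by (rule Ints_cases)
    from r A have "0 < r" "r < 1" by (force simp: divide_less_eq)+
    with k show False by simp
  qed
  obtain M where M: "M \<ge> B" "\<forall>r\<in>(\<lambda>a. a / \<alpha>) ` (A - {\<alpha>}). real M * r \<notin> \<int>"
    using nonintegral_multiples_exist[of "(\<lambda>a. a / \<alpha>) ` (A - {\<alpha>})" B, OF _ nonint] fin by blast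
  note BM = B[OF M(1)]
  have M0: "real M > 0" using BM a0 by linarith
  define D where "D a = nat \<lfloor>real M * (a / \<alpha>)\<rfloor>" for a
  have D: "real (D a) \<le> real M * (a / \<alpha>)" "real M * (a / \<alpha>) < real (D a) + 1"
    "q < D a" "a \<noteq> \<alpha> \<Longrightarrow> real (D a) \<noteq> real M * (a / \<alpha>)" if "a \<in> A" for a
  proof -
    have ge: "real (Suc q) \<le> real M * (a / \<alpha>)" using BM that by blast
    then have "0 \<le> \<lfloor>real M * (a / \<alpha>)\<rfloor>" by simp
    then have eq: "real (D a) = of_int \<lfloor>real M * (a / \<alpha>)\<rfloor>" by (simp add: D_def)
    show "real (D a) \<le> real M * (a / \<alpha>)" "real M * (a / \<alpha>) < real (D a) + 1"
      unfolding eq by linarith+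
    show "q < D a" using ge unfolding D_def by (simp add: le_nat_floor less_eq_Suc_le)
    show "real (D a) \<noteq> real M * (a / \<alpha>)" if "a \<noteq> \<alpha>"
    proof -
      from M(2) \<open>a \<in> A\<close> that have "real M * (a / \<alpha>) \<notin> \<int>" by blast
      then show ?thesis by (metis Ints_of_nat)
    qed
  qed
  have D\<alpha>: "D \<alpha> = M" using a0 by (simp add: D_def)
  have lt: "D a < D b" if ab: "a \<in> A" "b \<in> A" "a < b" for a b
  proof -
    have "1 \<le> real M * ((b - a) / \<alpha>)" using BM ab by blast
    then have "real M * (a / \<alpha>) + 1 \<le> real M * (b / \<alpha>)" by (simp add: field_simps diff_divide_distrib)
    with D(1)[OF ab(1)] D(2)[OF ab(2)] have "real (D a) < real (D b)" by linarith
    then show ?thesis by simp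
  qed
  show thesis
  proof (rule that[of D])
    show "inj_on D A"
      by (rule inj_onI) (metis lt linorder_neqE_linordered_idom less_irrefl)
    show "\<alpha> < D \<alpha>" using BM D\<alpha> by simp
    fix a assume a: "a \<in> A"
    have pos: "real (D a) > 0" using D(3)[OF a] by simp
    show "q \<le> D a \<and> 0 < D a" using D(3)[OF a] by simp
    show "a / (D a + 1) < \<alpha> / D \<alpha>"
      using D(2)[OF a] a0 M0 pos unfolding D\<alpha> by (simp add: field_simps)
    show "\<alpha> / D \<alpha> \<le> a / D a"
      using D(1)[OF a] a0 M0 pos unfolding D\<alpha> by (simp add: field_simps)
    assume "\<alpha> / D \<alpha> = a / D a"
    then have "real (D a) = real M * (a / \<alpha>)"
      using a0 M0 pos unfolding D\<alpha> by (simp add: field_simps)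
    with D(4)[OF a] show "a = \<alpha>" by blast
  qed
qed

text \<open>
  The conditions on \<open>\<eta>\<close>, in terms of the fractional degrees \<open>as\<close> and the Taylor degrees \<open>ds\<close>: the
  first one leaves room for \<open>L\<close> above \<open>H\<close>, and the second one gives different degrees to the leading
  terms of Taylor polynomials of different degrees. The last entries belong to \<open>g m\<close>.
\<close>

definition admissible_exponent :: "real list \<Rightarrow> nat list \<Rightarrow> real \<Rightarrow> bool" where
  "admissible_exponent as ds \<eta> \<longleftrightarrow>
     (let \<rho> = last as / last ds in
       (if last ds = 0 then \<eta> < 1
        else \<forall>j<length as. 0 < as ! j \<longrightarrow> as ! j / (ds ! j + 1) < \<rho> - \<eta>) \<and>
       (\<forall>i<length as. \<forall>j<length as. ds ! i \<noteq> ds ! j \<longrightarrow>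
          as ! i - ds ! i * (\<rho> - \<eta>) \<noteq> as ! j - ds ! j * (\<rho> - \<eta>)))"

text \<open>
  The strict inequalities hold at \<open>\<eta> = 0\<close> and persist for small \<open>\<eta>\<close>; the inequations fail for at most
  one \<open>\<eta>\<close> each.
\<close>

lemma admissible_exponent_bound_exists:
  assumes "last ds \<noteq> 0 \<Longrightarrow> \<forall>j<length as. 0 < as ! j \<longrightarrow> as ! j / (ds ! j + 1) < last as / last ds"
  shows "\<exists>E>0. \<forall>\<eta>. 0 < \<eta> \<and> \<eta> < E \<longrightarrow> admissible_exponent as ds \<eta>"
proof -
  let ?\<rho> = "last as / last ds"
  have small: "\<forall>\<^sub>F \<eta> in at_right 0. \<eta> < c" if "c > 0" for c :: real
    using that by (auto simp: eventually_at_right_field)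
  have ne: "\<forall>\<^sub>F \<eta> in at_right 0. ds ! i \<noteq> ds ! j \<longrightarrow>
      as ! i - ds ! i * (?\<rho> - \<eta>) \<noteq> as ! j - ds ! j * (?\<rho> - \<eta>)" for i j
  proof (cases "ds ! i = ds ! j")
    case False
    \<comment> \<open>the one value of \<open>\<eta>\<close> at which the two sides agree\<close>
    define c where "c = ?\<rho> - (as ! i - as ! j) / (real (ds ! i) - real (ds ! j))"
    have "\<forall>\<^sub>F \<eta> in at_right 0. \<eta> \<noteq> c" by (rule eventually_neq_at_within)
    then show ?thesis
    proof eventually_elim
      case (elim \<eta>)
      have "as ! i - as ! j \<noteq> (real (ds ! i) - real (ds ! j)) * (?\<rho> - \<eta>)"
      proof
        assume "as ! i - as ! j = (real (ds ! i) - real (ds ! j)) * (?\<rho> - \<eta>)"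
        then have "\<eta> = c" using False by (simp add: c_def)
        with elim show False by simp
      qed
      then show ?case by (simp add: left_diff_distrib)
    qed
  qed simp
  have sep: "\<forall>\<^sub>F \<eta> in at_right 0. if last ds = 0 then \<eta> < 1
      else \<forall>j\<in>{..<length as}. 0 < as ! j \<longrightarrow> as ! j / (ds ! j + 1) < ?\<rho> - \<eta>"
  proof (cases "last ds = 0")
    case True
    then show ?thesis using small[of 1] by simp
  next
    case False
    have "\<forall>\<^sub>F \<eta> in at_right 0. 0 < as ! j \<longrightarrow> as ! j / (ds ! j + 1) < ?\<rho> - \<eta>"
      if "j < length as" for j
    proof (cases "0 < as ! j")
      case True
      have "\<forall>\<^sub>F \<eta> in at_right 0. \<eta> < ?\<rho> - as ! j / (ds ! j + 1)"
        using assms[OF False] that True by (intro small) simp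
      then show ?thesis by eventually_elim linarith
    qed simp
    then show ?thesis using False by (simp add: eventually_ball_finite)
  qed
  have "\<forall>\<^sub>F \<eta> in at_right 0. \<forall>i\<in>{..<length as}. \<forall>j\<in>{..<length as}. ds ! i \<noteq> ds ! j \<longrightarrow>
      as ! i - ds ! i * (?\<rho> - \<eta>) \<noteq> as ! j - ds ! j * (?\<rho> - \<eta>)"
    by (intro eventually_ball_finite ballI ne) auto
  with sep have "\<forall>\<^sub>F \<eta> in at_right 0. admissible_exponent as ds \<eta>"
    by eventually_elim (auto simp: admissible_exponent_def Let_def split: if_splits)
  then show ?thesis by (auto simp: eventually_at_right_field)
qed

section \<open>The two scales\<close>

lemma smallo_imp_not_bigtheta:
  assumes "f \<in> o[at_top](g)" "\<forall>\<^sub>F t::real in at_top. g t \<noteq> 0"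
  shows "f \<notin> \<Theta>[at_top](g)"
proof
  assume "f \<in> \<Theta>[at_top](g)"
  then have "g \<in> O[at_top](f)" by (auto simp: bigtheta_def bigomega_iff_bigo)
  from landau_o.big_small_asymmetric[OF this assms(1)] assms(2)
  have "\<forall>\<^sub>F t::real in at_top. False" by eventually_elim auto
  then show False by simp
qed

text \<open>
  If \<open>m\<^sub>2 = m\<close>, then \<open>a m = 0\<close> and \<open>D m = 0\<close>, and the slope \<open>a m / D m\<close> is \<open>0\<close> by the convention for
  division by zero.
\<close>

locale growth_family = hardy_closed +
  fixes g :: "nat \<Rightarrow> real \<Rightarrow> real" and m m\<^sub>2 q :: nat and a :: "nat \<Rightarrow> real" and D :: "nat \<Rightarrow> nat"
  assumes m: "1 \<le> m" "m\<^sub>2 \<le> m"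
    and g: "i \<in> {1..m} \<Longrightarrow> g i \<in> K" "i \<in> {1..m} \<Longrightarrow> avoids_monomials (g i)"
      "i \<in> {1..m} \<Longrightarrow> has_fracdeg (g i) (a i)"
      "i \<in> {1..m} \<Longrightarrow> filterlim (\<lambda>t. \<bar>g i t\<bar>) at_top at_top"
    and chain: "i \<in> {1..m} \<Longrightarrow> j \<in> {1..m} \<Longrightarrow> i < j \<Longrightarrow> g i \<in> o[at_top](g j)"
    and a: "i \<in> {1..m\<^sub>2} \<Longrightarrow> a i = 0" "i \<in> {m\<^sub>2+1..m} \<Longrightarrow> 0 < a i"
    and D: "i \<in> {1..m\<^sub>2} \<Longrightarrow> D i = 0" "i \<in> {m\<^sub>2+1..m} \<Longrightarrow> q \<le> D i \<and> 0 < D i"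
      "i \<in> {1..m} \<Longrightarrow> j \<in> {1..m} \<Longrightarrow> D i = D j \<longleftrightarrow> a i = a j"
    and slope: "i \<in> {m\<^sub>2+1..m} \<Longrightarrow> a i / (D i + 1) < a m / D m"
      "i \<in> {m\<^sub>2+1..m} \<Longrightarrow> a m / D m \<le> a i / D i"
      "i \<in> {m\<^sub>2+1..m} \<Longrightarrow> a m / D m = a i / D i \<Longrightarrow> a i = a m"
      "a m / D m < 1"
begin

lemma g_deriv: "i \<in> {1..m} \<Longrightarrow> has_fracdeg ((deriv ^^ k) (g i)) (a i - real k)"
  by (intro has_fracdeg_higher_deriv g)

lemma deriv_scale_fracdeg:
  "i \<in> {1..m} \<Longrightarrow> 0 < k \<Longrightarrow> has_fracdeg (deriv_scale (g i) k) (1 - a i / real k)"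
  by (intro has_fracdeg_deriv_scale g_deriv)

lemma D_eq_0_iff: "i \<in> {1..m} \<Longrightarrow> D i = 0 \<longleftrightarrow> i \<le> m\<^sub>2"
  using D(1,2)[of i] by (cases "i \<le> m\<^sub>2") auto

abbreviation "lists_admissible \<equiv> admissible_exponent (map a [1..<m+1]) (map D [1..<m+1])"

lemma lists: "length (map a [1..<m+1]) = m" "last (map a [1..<m+1]) = a m"
  "last (map D [1..<m+1]) = D m"
  "j < m \<Longrightarrow> map a [1..<m+1] ! j = a (j + 1)" "j < m \<Longrightarrow> map D [1..<m+1] ! j = D (j + 1)"
  using m(1) by (auto simp: last_map simp del: upt_Suc simp flip: Suc_eq_plus1) 

lemma admissible_exponentD:
  assumes "lists_admissible \<eta>"
  shows "D m = 0 \<Longrightarrow> \<eta> < 1"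
    and "i \<in> {m\<^sub>2+1..m} \<Longrightarrow> a i / (D i + 1) < a m / D m - \<eta>"
    and "i \<in> {1..m} \<Longrightarrow> j \<in> {1..m} \<Longrightarrow> a i \<noteq> a j \<Longrightarrow>
      a i - D i * (a m / D m - \<eta>) \<noteq> a j - D j * (a m / D m - \<eta>)"
proof -
  note adm = assms[unfolded admissible_exponent_def Let_def lists]
  show "D m = 0 \<Longrightarrow> \<eta> < 1" using adm by simp
  show "a i / (D i + 1) < a m / D m - \<eta>" if i: "i \<in> {m\<^sub>2+1..m}"
  proof -
    have "D m \<noteq> 0" using D_eq_0_iff[of m] i m by auto
    then have "\<forall>j<m. 0 < map a [1..<m+1] ! j \<longrightarrow>
        map a [1..<m+1] ! j / (map D [1..<m+1] ! j + 1) < a m / D m - \<eta>"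
      using adm by simp
    from this[rule_format, of "i - 1"] show ?thesis using i a(2)[OF i] lists(4,5)[of "i - 1"] by auto
  qed
  show "a i - D i * (a m / D m - \<eta>) \<noteq> a j - D j * (a m / D m - \<eta>)"
    if ij: "i \<in> {1..m}" "j \<in> {1..m}" "a i \<noteq> a j"
  proof -
    have less: "i - 1 < m" "j - 1 < m" using ij by auto
    then show ?thesis
      using adm[THEN conjunct2, rule_format, OF less] ij(1,2) ij(3) D(3)[OF ij(1,2)]
        lists(4,5)[OF less(1)] lists(4,5)[OF less(2)] by simp
  qed
qed

lemma admissible_bound_exists: "\<exists>E>0. \<forall>\<eta>. 0 < \<eta> \<and> \<eta> < E \<longrightarrow> lists_admissible \<eta>"
proof (rule admissible_exponent_bound_exists, unfold lists, intro allI impI)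
  fix j assume "j < m" "0 < map a [1..<m+1] ! j"
  then have "j + 1 \<in> {m\<^sub>2+1..m}" using a(1)[of "j + 1"] lists(4)[of j] by fastforce
  from slope(1)[OF this] \<open>j < m\<close>
  show "map a [1..<m+1] ! j / real (map D [1..<m+1] ! j + 1) < a m / real (D m)"
    using lists(4,5)[of j] by simp
qed

definition H_deg :: "real \<Rightarrow> real" where
  "H_deg \<eta> = (if D m > 0 then 1 - a m / D m + \<eta> else \<eta>)"

lemma H_fracdeg: "has_fracdeg (H_form (g m) (D m) \<eta>) (H_deg \<eta>)"
proof (cases "D m > 0")
  case True
  have "has_fracdeg (\<lambda>N. deriv_scale (g m) (D m) N * N powr \<eta>) (1 - a m / D m + \<eta>)"
    using m True by (intro has_fracdeg_mult has_fracdeg_powr deriv_scale_fracdeg) auto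
  then show ?thesis using True unfolding H_form_def[abs_def] H_deg_def by simp
next
  case False
  then show ?thesis unfolding H_form_def[abs_def] H_deg_def by (simp add: has_fracdeg_powr)
qed

lemma H_pos: "\<forall>\<^sub>F t in at_top. H_form (g m) (D m) \<eta> t > 0"
proof -
  have "\<forall>\<^sub>F t in at_top. (deriv ^^ D m) (g m) t \<noteq> 0"
    using m by (intro has_fracdegD(2)[OF g_deriv]) auto
  with eventually_gt_at_top[of 0] show ?thesis
    by eventually_elim (auto simp: H_form_def deriv_scale_def)
qed

lemma H_deg_bounds:
  assumes "0 < \<eta>" "lists_admissible \<eta>"
  shows "0 < H_deg \<eta>" "H_deg \<eta> < 1" "i \<in> {m\<^sub>2+1..m} \<Longrightarrow> H_deg \<eta> < 1 - a i / (D i + 1)"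
proof -
  have pos: "D m > 0" if "i \<in> {m\<^sub>2+1..m}" for i using D_eq_0_iff[of m] that m by auto
  show upper: "H_deg \<eta> < 1 - a i / (D i + 1)" if "i \<in> {m\<^sub>2+1..m}" for i
    using admissible_exponentD(2)[OF assms(2) that] pos[OF that] by (simp add: H_deg_def)
  show "0 < H_deg \<eta>" using assms(1) slope(4) by (simp add: H_deg_def)
  show "H_deg \<eta> < 1"
  proof (cases "D m = 0")
    case True
    then show ?thesis using admissible_exponentD(1)[OF assms(2)] by (simp add: H_deg_def)
  next
    case False
    then have mm: "m \<in> {m\<^sub>2+1..m}" using D_eq_0_iff[of m] m by auto
    have "a m / (D m + 1) > 0" using a(2)[OF mm] by simp
    with upper[OF mm] show ?thesis by linarith
  qed
qed

lemma H_mem: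
  assumes "(\<lambda>t. t powr \<eta>) \<in> K"
  shows "H_form (g m) (D m) \<eta> \<in> poly_growth_part K"
proof (rule poly_growth_partI[OF _ H_fracdeg])
  have "- 1 / real (D m) \<in> \<rat>" by simp
  moreover have "m \<in> {1..m}" using m by simp
  ultimately have "deriv_scale (g m) (D m) \<in> K"
    unfolding deriv_scale_def[abs_def]
    by (intro rational_abs_powr_mem higher_deriv_mem g has_fracdegD(2)[OF g_deriv])
  then show "H_form (g m) (D m) \<eta> \<in> K"
    using assms unfolding H_form_def[abs_def] by (cases "D m > 0") (auto intro: mult_mem)
qed

text \<open>
  The growth of \<open>H\<close> is needed as a lower bound for \<open>L\<close>: the unspecified value of \<open>fracdeg L\<close> might
  lie between \<open>0\<close> and \<open>1\<close> even if \<open>t L' / L\<close> tended to minus infinity.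
\<close>

lemma L_fracdeg:
  assumes "L \<in> poly_growth_part K" "H_form (g m) (D m) \<eta> \<in> o[at_top](L)"
  shows "has_fracdeg L (fracdeg L)"
proof -
  obtain c where c: "L \<in> K" "L \<in> O[at_top](\<lambda>t. t powr c)"
    using assms(1) unfolding poly_growth_part_def by blast
  \<comment> \<open>any exponent below the degree of \<open>H\<close> would do\<close>
  have "(\<lambda>t. t powr (H_deg \<eta> - 1)) \<in> o[at_top](H_form (g m) (D m) \<eta>)"
    by (rule has_fracdeg_less_imp_smallo[OF has_fracdeg_powr H_fracdeg]) simp
  from landau_o.small_imp_big[OF landau_o.small_trans[OF this assms(2)]]
  show ?thesis by (rule fracdeg_exists[OF c(1) _ c(2)])
qed

text \<open>
  For \<open>i > m\<^sub>2\<close> the bound on the remainder is the \<open>(D i + 1)\<close>-st power of the quotient of \<open>L\<close> by the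
  scale that dominates it; for \<open>i \<le> m\<^sub>2\<close> it is \<open>\<bar>g\<^sub>i'\<bar> L\<close>, of degree \<open>b - 1\<close>.
\<close>

lemma taylor_limit:
  assumes i: "i \<in> {1..m}"
    and L: "has_fracdeg L b" "0 < b" "b < 1" "\<forall>\<^sub>F t in at_top. L t > 0"
    and sep: "i > m\<^sub>2 \<Longrightarrow> L \<lless> deriv_scale (g i) (D i + 1)"
  shows "(\<lambda>N::nat. MAX n\<in>{n::nat. 1 \<le> n \<and> real n \<le> L (real N)}.
           \<bar>g i (real N + real n) - taylor_approx (g i) (D i) (real N) (real n)\<bar>) \<longlonglongrightarrow> 0"
proof (rule taylor_error_tendsto_0[OF g(1)[OF i] g_deriv[OF i]])
  let ?k = "Suc (D i)"
  let ?u = "(deriv ^^ ?k) (g i)"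
  note u = g_deriv[OF i, of ?k]
  show "a i - real ?k < 0"
  proof (cases "i \<le> m\<^sub>2")
    case True
    then show ?thesis using a(1)[of i] i by simp
  next
    case False
    then have "i \<in> {m\<^sub>2+1..m}" using i by simp
    from less_trans[OF slope(1)[OF this] slope(4)] show ?thesis by (simp add: field_simps)
  qed
  show "filterlim L at_top at_top"
    by (rule filterlim_cong[THEN iffD1, OF refl refl _ has_fracdeg_pos_imp_at_top[OF L(1,2)]])
      (use L(4) in eventually_elim, simp)
  show "((\<lambda>t. \<bar>?u t\<bar> * L t ^ ?k) \<longlongrightarrow> 0) at_top"
  proof (cases "i \<le> m\<^sub>2")
    case True
    then have "a i = 0" "D i = 0" using a(1)[of i] D(1)[of i] i by auto
    moreover have "has_fracdeg (\<lambda>t. \<bar>?u t\<bar> * L t ^ ?k) (a i - real ?k + real ?k * b)"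
      by (intro has_fracdeg_mult has_fracdeg_abs u has_fracdeg_power L)
    ultimately show ?thesis using L(3) by (intro has_fracdeg_neg_imp_tendsto_0) auto
  next
    case False
    let ?s = "deriv_scale (g i) ?k"
    obtain \<delta> where \<delta>: "\<delta> > 0" "(\<lambda>t. \<bar>L t\<bar> * t powr \<delta>) \<in> o[at_top](?s)"
      using sep False unfolding power_smaller_def by auto
    have "\<forall>\<^sub>F t in at_top. norm (L t) \<le> norm (\<bar>L t\<bar> * t powr \<delta>)"
      using eventually_ge_at_top[of 1]
    proof eventually_elim
      case (elim t)
      then have "1 \<le> t powr \<delta>" using \<delta>(1) by (simp add: ge_one_powr_ge_zero)
      then have "\<bar>L t\<bar> * 1 \<le> \<bar>L t\<bar> * t powr \<delta>" by (intro mult_left_mono) auto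
      then show ?case by (simp add: abs_mult)
    qed
    then have "L \<in> O[at_top](\<lambda>t. \<bar>L t\<bar> * t powr \<delta>)" by (rule landau_o.big_mono)
    from smalloD_tendsto[OF landau_o.big_small_trans[OF this \<delta>(2)]]
    have "((\<lambda>t. (L t / ?s t) ^ ?k) \<longlongrightarrow> 0 ^ ?k) at_top" by (rule tendsto_power)
    then have "((\<lambda>t. (L t / ?s t) ^ ?k) \<longlongrightarrow> 0) at_top" by simp
    then show ?thesis
    proof (rule Lim_transform_eventually)
      show "\<forall>\<^sub>F t in at_top. (L t / ?s t) ^ ?k = \<bar>?u t\<bar> * L t ^ ?k"
        using has_fracdegD(2)[OF u]
      proof eventually_elim
        case (elim t)
        have "?s t ^ ?k = \<bar>?u t\<bar> powr (- 1 / real ?k * real ?k)"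
          unfolding deriv_scale_def using elim
          by (subst powr_realpow[symmetric]) (simp_all add: powr_powr del: funpow.simps of_nat_Suc)
        also have "\<dots> = 1 / \<bar>?u t\<bar>" using elim by (simp add: powr_minus_divide del: funpow.simps)
        finally show ?case by (simp add: power_divide mult.commute del: funpow.simps power_Suc)
      qed
    qed
  qed
qed

text \<open>
  Functions of different degrees give terms of different degrees, by the choice of \<open>\<eta>\<close>. Functions of
  equal degrees have equal Taylor degrees, and the order of growth carries over to the derivatives.
\<close>

lemma leading_terms_not_bigtheta:
  assumes "lists_admissible \<eta>" and ij: "i \<in> {1..m}" "j \<in> {1..m}" "i \<noteq> j"
  defines "F \<equiv> \<lambda>i t. (deriv ^^ D i) (g i) t * H_form (g m) (D m) \<eta> t ^ D i"
  shows "F i \<notin> \<Theta>[at_top](F j)"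
proof -
  have F: "has_fracdeg (F i) (a i - D i + D i * H_deg \<eta>)" if "i \<in> {1..m}" for i
    unfolding F_def using that by (intro has_fracdeg_mult g_deriv has_fracdeg_power H_fracdeg)
  show ?thesis
  proof (cases "a i = a j")
    case False
    then have "D i \<noteq> D j" using D(3)[OF ij(1,2)] by simp
    then have "D m > 0" using D_eq_0_iff[of m] D_eq_0_iff[OF ij(1)] D_eq_0_iff[OF ij(2)] m ij
      by (cases "D m = 0") auto
    then have "a i - D i + D i * H_deg \<eta> \<noteq> a j - D j + D j * H_deg \<eta>"
      using admissible_exponentD(3)[OF assms(1) ij(1,2) False]
      by (simp add: H_deg_def algebra_simps)
    from has_fracdeg_distinct_imp_not_bigtheta[OF F[OF ij(1)] F[OF ij(2)] this] show ?thesis .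
  next
    case True
    have less: "F i \<in> o[at_top](F j)" if "i \<in> {1..m}" "j \<in> {1..m}" "i < j" "a i = a j" for i j
    proof -
      have eq: "D i = D j" using D(3) that by blast
      have "(deriv ^^ D j) (g i) \<in> o[at_top]((deriv ^^ D j) (g j))"
        using that by (intro higher_deriv_smallo g has_fracdegD(2)[OF g(3)] chain)
      then show ?thesis unfolding F_def eq by (rule landau_o.small_big_mult) simp
    qed
    consider "i < j" | "j < i" using ij(3) by linarith
    then show ?thesis
    proof cases
      case 1
      then show ?thesis using less True ij F by (intro smallo_imp_not_bigtheta has_fracdegD(2))
    next
      case 2
      then have "F j \<notin> \<Theta>[at_top](F i)"
        using less[OF ij(2,1)] True by (intro smallo_imp_not_bigtheta has_fracdegD(2)[OF F[OF ij(1)]]) auto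
      then show ?thesis by (simp add: bigtheta_sym)
    qed
  qed
qed

lemma good_scalesI:
  assumes \<eta>: "0 < \<eta>" "lists_admissible \<eta>"
    and L: "L \<in> poly_growth_part K" "positive_sublinear L"
      "H_form (g m) (D m) \<eta> \<in> o[at_top](L)" "scales_separated g m m\<^sub>2 D (H_form (g m) (D m) \<eta>) L"
  shows "good_scales g m m\<^sub>2 q D (H_form (g m) (D m) \<eta>) L"
proof -
  let ?H = "H_form (g m) (D m) \<eta>"
  have fg: "fracdeg (g i) = a i" if "i \<in> {1..m}" for i using g(3)[OF that] by (rule has_fracdegD)
  have fds: "fracdeg (deriv_scale (g i) (D i)) = 1 - a i / D i" if "i \<in> {m\<^sub>2+1..m}" for i
    using that D(2)[OF that] by (intro has_fracdegD(4) deriv_scale_fracdeg) auto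
  have posH: "positive_sublinear ?H"
    unfolding positive_sublinear_def
    using H_pos H_deg_bounds[OF \<eta>] has_fracdegD(4)[OF H_fracdeg] by auto
  have growth: "filterlim (\<lambda>N::nat. \<bar>(deriv ^^ D i) (g i) (real N)\<bar> * real N ^ D i) at_top sequentially"
    if i: "i \<in> {1..m}" for i
  proof (rule filterlim_compose[OF _ filterlim_real_sequentially])
    show "filterlim (\<lambda>t. \<bar>(deriv ^^ D i) (g i) t\<bar> * t ^ D i) at_top at_top"
    proof (cases "i \<le> m\<^sub>2")
      case True
      then have "D i = 0" using D(1)[of i] i by simp
      then show ?thesis using g(4)[OF i] by simp
    next
      case False
      let ?f = "\<lambda>t. (deriv ^^ D i) (g i) t * (t powr 1) ^ D i"
      have "has_fracdeg ?f (a i - D i + real (D i) * 1)"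
        by (intro has_fracdeg_mult g_deriv[OF i] has_fracdeg_power has_fracdeg_powr)
      then have "filterlim (\<lambda>t. \<bar>?f t\<bar>) at_top at_top"
        using a(2)[of i] i False by (intro has_fracdeg_pos_imp_at_top) auto
      then show ?thesis
        by (rule filterlim_cong[THEN iffD1, OF refl refl, rotated])
          (use eventually_gt_at_top[of 0] in \<open>eventually_elim, simp add: abs_mult\<close>)
    qed
  qed
  have taylor: "(\<lambda>N::nat. MAX n\<in>{n::nat. 1 \<le> n \<and> real n \<le> L (real N)}.
           \<bar>g i (real N + real n) - taylor_approx (g i) (D i) (real N) (real n)\<bar>) \<longlonglongrightarrow> 0"
    if i: "i \<in> {1..m}" for i
  proof (rule taylor_limit[OF i L_fracdeg[OF L(1,3)]])
    show "0 < fracdeg L" "fracdeg L < 1" "\<forall>\<^sub>F t in at_top. L t > 0"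
      using L(2) unfolding positive_sublinear_def by blast+
    assume "i > m\<^sub>2"
    then have "i \<in> {m\<^sub>2+1..m}" using i by simp
    with L(4) show "L \<lless> deriv_scale (g i) (D i + 1)" unfolding scales_separated_def by blast
  qed
  show ?thesis
    unfolding good_scales_def
  proof (intro conjI ballI impI)
    show "positive_sublinear ?H" "positive_sublinear L" "scales_separated g m m\<^sub>2 D ?H L"
      by (fact posH L)+
  next
    fix i assume "i \<in> {m\<^sub>2+1..m}"
    then have i: "i \<in> {m\<^sub>2+1..m}" "i \<in> {1..m}" "m \<in> {m\<^sub>2+1..m}" "m \<in> {1..m}" by auto
    show "fracdeg (deriv_scale (g i) (D i)) \<le> fracdeg (deriv_scale (g m) (D m))"
      using slope(2)[OF i(1)] by (simp add: fds[OF i(1)] fds[OF i(3)])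
    show "fracdeg (deriv_scale (g i) (D i)) = fracdeg (deriv_scale (g m) (D m))
           \<longleftrightarrow> fracdeg (g i) = fracdeg (g m)"
      using slope(3)[OF i(1)] D(3)[OF i(2,4)]
      by (auto simp: fds[OF i(1)] fds[OF i(3)] fg[OF i(2)] fg[OF i(4)])
  next
    fix i j assume ij: "i \<in> {1..m}" "j \<in> {1..m}"
    show "D i = D j \<longleftrightarrow> fracdeg (g i) = fracdeg (g j)" using D(3)[OF ij] fg ij by simp
    show "i \<noteq> j \<Longrightarrow> (\<lambda>t. (deriv ^^ D i) (g i) t * ?H t ^ D i)
          \<notin> \<Theta>[at_top](\<lambda>t. (deriv ^^ D j) (g j) t * ?H t ^ D j)"
      by (rule leading_terms_not_bigtheta[OF \<eta>(2) ij])
  next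
    fix i assume i: "i \<in> {1..m}"
    show "if i > m\<^sub>2 then D i \<ge> q else D i = 0" using D(1,2)[of i] i by auto
  qed (fact growth taylor)+
qed

text \<open>
  There is a rational number between the degree of \<open>H\<close> and the finitely many upper bounds.
\<close>

lemma L_exists:
  assumes \<eta>: "0 < \<eta>" "lists_admissible \<eta>"
  shows "\<exists>L\<in>poly_growth_part K. H_form (g m) (D m) \<eta> \<in> o[at_top](L) \<and>
    good_scales g m m\<^sub>2 q D (H_form (g m) (D m) \<eta>) L"
proof -
  let ?X = "insert 1 ((\<lambda>i. 1 - a i / (D i + 1)) ` {m\<^sub>2+1..m})"
  have "H_deg \<eta> < Min ?X" using H_deg_bounds[OF \<eta>] by (subst Min_gr_iff) auto
  from Rats_dense_in_real[OF this] obtain r where r: "r \<in> \<rat>" "H_deg \<eta> < r" "r < Min ?X" by blast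
  then have r1: "r < 1" and ri: "\<And>i. i \<in> {m\<^sub>2+1..m} \<Longrightarrow> r < 1 - a i / (D i + 1)" by auto
  let ?L = "\<lambda>t::real. t powr r"
  have L: "?L \<in> poly_growth_part K"
    by (rule poly_growth_partI[OF rational_powr_mem[OF r(1)] has_fracdeg_powr])
  moreover have "positive_sublinear ?L"
    unfolding positive_sublinear_def
    using r r1 H_deg_bounds(1)[OF \<eta>] has_fracdegD(4)[OF has_fracdeg_powr[of r]]
    by (auto intro: eventually_mono[OF eventually_gt_at_top[of 0]])
  moreover have o: "H_form (g m) (D m) \<eta> \<in> o[at_top](?L)"
    by (rule has_fracdeg_less_imp_smallo[OF H_fracdeg has_fracdeg_powr r(2)])
  moreover have "scales_separated g m m\<^sub>2 D (H_form (g m) (D m) \<eta>) ?L"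
    unfolding scales_separated_def
  proof (intro ballI conjI)
    fix i j assume i: "i \<in> {m\<^sub>2+1..m}" and j: "j \<in> {m\<^sub>2+1..m}"
    have "D m > 0" using D_eq_0_iff[of m] i m by auto
    then have "1 - a i / D i < H_deg \<eta>" using slope(2)[OF i] \<eta>(1) by (simp add: H_deg_def)
    then show "deriv_scale (g i) (D i) \<lless> H_form (g m) (D m) \<eta>"
      using i D(2)[OF i]
      by (intro has_fracdeg_less_imp_power_smaller[OF deriv_scale_fracdeg H_fracdeg]) auto
    show "H_form (g m) (D m) \<eta> \<lless> ?L"
      by (rule has_fracdeg_less_imp_power_smaller[OF H_fracdeg has_fracdeg_powr r(2)])
    have "has_fracdeg (deriv_scale (g j) (D j + 1)) (1 - a j / real (D j + 1))"
      using j by (intro deriv_scale_fracdeg) auto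
    then show "?L \<lless> deriv_scale (g j) (D j + 1)"
      by (rule has_fracdeg_less_imp_power_smaller[OF has_fracdeg_powr]) (use ri[OF j] in simp)
  qed
  ultimately show ?thesis using good_scalesI[OF \<eta>] by blast
qed

end

section \<open>Existence of the scales\<close>

text \<open>
  Choosing from the two lists alone makes the bound a function of the degrees; lemma
  \<open>admissible_exponent_bound_exists\<close> provides a possible choice.
\<close>

definition exponent_bound :: "real list \<Rightarrow> nat list \<Rightarrow> real" where
  "exponent_bound as ds = (SOME E. E > 0 \<and> (\<forall>\<eta>. 0 < \<eta> \<and> \<eta> < E \<longrightarrow> admissible_exponent as ds \<eta>))"

lemma smallo_chain:
  assumes "\<And>i. i \<in> {1..<m} \<Longrightarrow> g i \<in> o[F](g (i + 1))" "1 \<le> i" "i < j" "j \<le> (m::nat)"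
  shows "g i \<in> o[F](g j)"
proof -
  from \<open>i < j\<close> have "Suc i \<le> j" by simp
  then show ?thesis using \<open>j \<le> m\<close>
  proof (induction j rule: dec_induct)
    case base
    then show ?case using assms(1)[of i] assms(2) by simp
  next
    case (step n)
    then have "g i \<in> o[F](g n)" "g n \<in> o[F](g (n + 1))" using assms(1)[of n] assms(2) by auto
    then show ?case using landau_o.small_trans by fastforce
  qed
qed

theorem proposition10p3:
  "\<exists>\<eta>\<^sub>0 :: real list \<Rightarrow> nat list \<Rightarrow> real.
     \<forall>(\<H>\<^sub>0 :: (real \<Rightarrow> real) set) (d::nat) (m::nat) (m\<^sub>2::nat) (q::nat) (g :: nat \<Rightarrow> real \<Rightarrow> real).
       hardy_field \<H>\<^sub>0 \<and> closed_under_composition \<H>\<^sub>0 \<and> closed_under_inversion \<H>\<^sub>0 \<and>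
       m \<ge> 1 \<and> m\<^sub>2 \<le> m \<and>
       (\<forall>i\<in>{1..m}. g i \<in> poly_growth_part \<H>\<^sub>0 \<and> strongly_nonpolynomial (g i)) \<and>
       (\<lambda>_. 1) \<in> o[at_top](g 1) \<and>
       (\<forall>i\<in>{1..<m}. g i \<in> o[at_top](g (i + 1))) \<and>
       g m \<in> O[at_top](\<lambda>t. t ^ d) \<and>
       (\<forall>i\<in>{1..m}. fracdeg (g i) = 0 \<longleftrightarrow> i \<in> {1..m\<^sub>2})
     \<longrightarrow>
       (\<exists>D :: nat \<Rightarrow> nat.
          let \<H> = poly_growth_part \<H>\<^sub>0;
              E = \<eta>\<^sub>0 (map (\<lambda>i. fracdeg (g i)) [1..<m+1]) (map D [1..<m+1])
          in E > 0 \<and>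
             (\<exists>H\<in>\<H>. \<exists>L\<in>\<H>. (\<exists>\<eta>. 0 < \<eta> \<and> \<eta> < E \<and> H = H_form (g m) (D m) \<eta>) \<and>
                good_scales g m m\<^sub>2 q D H L) \<and>
             (\<forall>\<eta>. 0 < \<eta> \<and> \<eta> < E \<longrightarrow>
                (let H = H_form (g m) (D m) \<eta>
                 in ((\<lambda>t. t powr \<eta>) \<in> \<H>\<^sub>0 \<longrightarrow> H \<in> \<H>) \<and>
                    (\<exists>L\<in>\<H>. H \<in> o[at_top](L) \<and> good_scales g m m\<^sub>2 q D H L) \<and>
                    (\<forall>L\<in>\<H>. positive_sublinear L \<and> H \<in> o[at_top](L) \<and>
                        scales_separated g m m\<^sub>2 D H L \<longrightarrow> good_scales g m m\<^sub>2 q D H L))))"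
proof (intro exI[of _ exponent_bound] allI impI, elim conjE)
  fix K :: "(real \<Rightarrow> real) set" and d m m\<^sub>2 q :: nat and g :: "nat \<Rightarrow> real \<Rightarrow> real"
  assume K: "hardy_field K" "closed_under_composition K" "closed_under_inversion K"
    and m: "m \<ge> 1" "m\<^sub>2 \<le> m"
    and gK: "\<forall>i\<in>{1..m}. g i \<in> poly_growth_part K \<and> strongly_nonpolynomial (g i)"
    and g1: "(\<lambda>_. 1) \<in> o[at_top](g 1)"
    and g_step: "\<forall>i\<in>{1..<m}. g i \<in> o[at_top](g (i + 1))"
    and fd0: "\<forall>i\<in>{1..m}. fracdeg (g i) = 0 \<longleftrightarrow> i \<in> {1..m\<^sub>2}"
  define a where "a i = fracdeg (g i)" for i
  have chain: "g i \<in> o[at_top](g j)" if "i \<in> {1..m}" "j \<in> {1..m}" "i < j" for i j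
    using smallo_chain[of m g at_top i j] g_step that by auto
  have one: "(\<lambda>_. 1) \<in> o[at_top](g i)" if i: "i \<in> {1..m}" for i
  proof (cases "i = 1")
    case False
    with i have "g 1 \<in> o[at_top](g i)" by (intro chain) auto
    with g1 show ?thesis by (rule landau_o.small_trans)
  qed (use g1 in simp)
  have inf: "filterlim (g i) at_infinity at_top" if "i \<in> {1..m}" for i
    using one[OF that] by (simp add: smallomega_iff_smallo flip: smallomega_1_conv_filterlim)
  interpret hardy K by standard (fact K)
  have mem: "g i \<in> K" if "i \<in> {1..m}" for i using gK that unfolding poly_growth_part_def by blast
  interpret hardy_closed K
    by standard (use K ident_mem_if_unbounded[OF K(2,3) mem inf, of 1] m in auto)
  have fg: "has_fracdeg (g i) (a i)" if i: "i \<in> {1..m}" for i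
  proof -
    from gK i obtain c where c: "g i \<in> O[at_top](\<lambda>t. t powr c)" unfolding poly_growth_part_def by blast
    have "\<forall>\<^sub>F t::real in at_top. norm (t powr 0) \<le> 1 * norm (1::real)"
      using eventually_gt_at_top[of 0] by eventually_elim simp
    then have "(\<lambda>t. t powr 0) \<in> O[at_top](\<lambda>_. 1 :: real)" by (rule bigoI)
    from landau_o.small_imp_big[OF landau_o.big_small_trans[OF this one[OF i]]]
    show ?thesis unfolding a_def by (rule fracdeg_exists[OF mem[OF i] _ c])
  qed
  have a_mono: "a i \<le> a j" if "i \<in> {1..m}" "j \<in> {1..m}" "i \<le> j" for i j
    using smallo_imp_fracdeg_le[OF fg fg chain] that by (cases "i = j") auto
  have a_nonneg: "0 \<le> a i" if i: "i \<in> {1..m}" for i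
  proof (rule ccontr)
    assume "\<not> 0 \<le> a i"
    then have "(g i \<longlongrightarrow> 0) at_top" using fg[OF i] by (intro has_fracdeg_neg_imp_tendsto_0) auto
    with inf[OF i] show False
      by (metis not_tendsto_and_filterlim_at_infinity trivial_limit_at_top_linorder)
  qed
  have a0: "a i = 0" if "i \<in> {1..m\<^sub>2}" for i using fd0 that m unfolding a_def by auto
  have a_pos: "0 < a i" if "i \<in> {m\<^sub>2+1..m}" for i
  proof -
    have i: "i \<in> {1..m}" "i \<notin> {1..m\<^sub>2}" using that by auto
    with fd0 have "a i \<noteq> 0" unfolding a_def by blast
    with a_nonneg[OF i(1)] show ?thesis by simp
  qed
  obtain D :: "nat \<Rightarrow> nat" where "growth_family K g m m\<^sub>2 q a D"
  proof (cases "m\<^sub>2 = m")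
    \<comment> \<open>all fractional degrees are \<open>0\<close>\<close>
    case True
    have "growth_family K g m m\<^sub>2 q a (\<lambda>_. 0)"
    proof
      fix i assume i: "i \<in> {1..m}"
      show "filterlim (\<lambda>t. \<bar>g i t\<bar>) at_top at_top"
        using filterlim_at_infinity_imp_norm_at_top[OF inf[OF i]] by simp
      show "avoids_monomials (g i)"
        using gK i by (intro strongly_nonpolynomial_imp_avoids_monomials) blast
    qed (use m mem fg chain a0 True in auto)
    then show thesis by (rule that)
  next
    case False
    then have mm: "m \<in> {m\<^sub>2+1..m}" using m by auto
    let ?A = "a ` {m\<^sub>2+1..m}"
    have A: "0 < x \<and> x \<le> a m" if "x \<in> ?A" for x using that a_pos a_mono m by auto
    obtain \<Delta> :: "real \<Rightarrow> nat" where \<Delta>: "inj_on \<Delta> ?A" "a m < \<Delta> (a m)"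
      "\<And>x. x \<in> ?A \<Longrightarrow> q \<le> \<Delta> x \<and> 0 < \<Delta> x"
      "\<And>x. x \<in> ?A \<Longrightarrow> x / (\<Delta> x + 1) < a m / \<Delta> (a m)"
      "\<And>x. x \<in> ?A \<Longrightarrow> a m / \<Delta> (a m) \<le> x / \<Delta> x"
      "\<And>x. x \<in> ?A \<Longrightarrow> a m / \<Delta> (a m) = x / \<Delta> x \<Longrightarrow> x = a m"
      using taylor_degrees_exist[of ?A "a m" q] A mm by blast
    define D where "D i = (if i \<le> m\<^sub>2 then 0 else \<Delta> (a i))" for i
    have Dm: "D m = \<Delta> (a m)" using mm by (simp add: D_def)
    have "growth_family K g m m\<^sub>2 q a D"
    proof
      fix i j assume ij: "i \<in> {1..m}" "j \<in> {1..m}"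
      have pos: "a k > 0" "\<Delta> (a k) > 0" if "k \<in> {1..m}" "\<not> k \<le> m\<^sub>2" for k
        using a_pos[of k] \<Delta>(3)[of "a k"] that by auto
      have zero: "a k = 0" if "k \<in> {1..m}" "k \<le> m\<^sub>2" for k using a0[of k] that by simp
      show "D i = D j \<longleftrightarrow> a i = a j"
        using pos[OF ij(1)] pos[OF ij(2)] zero[OF ij(1)] zero[OF ij(2)] inj_onD[OF \<Delta>(1), of "a i" "a j"] ij
        by (cases "i \<le> m\<^sub>2"; cases "j \<le> m\<^sub>2") (auto simp: D_def)
    next
      fix i assume i: "i \<in> {m\<^sub>2+1..m}"
      then have Ai: "a i \<in> ?A" and Di: "D i = \<Delta> (a i)" by (auto simp: D_def)
      show "q \<le> D i \<and> 0 < D i" "a i / (D i + 1) < a m / D m" "a m / D m \<le> a i / D i"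
        "a m / D m = a i / D i \<Longrightarrow> a i = a m"
        unfolding Di Dm using \<Delta>(3-6)[OF Ai] by blast+
      show "0 < a i" by (rule a_pos[OF i])
    next
      show "a m / D m < 1" using \<Delta>(2) a_pos[OF mm] unfolding Dm by simp
    next
      fix i assume i: "i \<in> {1..m}"
      show "filterlim (\<lambda>t. \<bar>g i t\<bar>) at_top at_top"
        using filterlim_at_infinity_imp_norm_at_top[OF inf[OF i]] by simp
      show "avoids_monomials (g i)"
        using gK i by (intro strongly_nonpolynomial_imp_avoids_monomials) blast
    qed (use m mem fg chain a0 in \<open>auto simp: D_def\<close>)
    then show thesis by (rule that)
  qed
  then interpret growth_family K g m m\<^sub>2 q a D .
  let ?E = "exponent_bound (map (\<lambda>i. fracdeg (g i)) [1..<m+1]) (map D [1..<m+1])"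
  have E: "?E > 0" "\<And>\<eta>. 0 < \<eta> \<Longrightarrow> \<eta> < ?E \<Longrightarrow> lists_admissible \<eta>"
    using someI_ex[OF admissible_bound_exists] unfolding exponent_bound_def a_def by blast+
  \<comment> \<open>a rational exponent, for which \<open>t powr r\<close> and hence \<open>H\<close> lie in the field\<close>
  obtain r where r: "r \<in> \<rat>" "0 < r" "r < ?E" using Rats_dense_in_real[OF E(1)] by blast
  show "\<exists>D :: nat \<Rightarrow> nat.
          let \<H> = poly_growth_part K;
              E = exponent_bound (map (\<lambda>i. fracdeg (g i)) [1..<m+1]) (map D [1..<m+1])
          in E > 0 \<and>
             (\<exists>H\<in>\<H>. \<exists>L\<in>\<H>. (\<exists>\<eta>. 0 < \<eta> \<and> \<eta> < E \<and> H = H_form (g m) (D m) \<eta>) \<and>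
                good_scales g m m\<^sub>2 q D H L) \<and>
             (\<forall>\<eta>. 0 < \<eta> \<and> \<eta> < E \<longrightarrow>
                (let H = H_form (g m) (D m) \<eta>
                 in ((\<lambda>t. t powr \<eta>) \<in> K \<longrightarrow> H \<in> \<H>) \<and>
                    (\<exists>L\<in>\<H>. H \<in> o[at_top](L) \<and> good_scales g m m\<^sub>2 q D H L) \<and>
                    (\<forall>L\<in>\<H>. positive_sublinear L \<and> H \<in> o[at_top](L) \<and>
                        scales_separated g m m\<^sub>2 D H L \<longrightarrow> good_scales g m m\<^sub>2 q D H L)))"
    unfolding Let_def
  proof (intro exI[of _ D] conjI allI impI ballI)
    show "?E > 0" by (rule E)
    show "\<exists>H\<in>poly_growth_part K. \<exists>L\<in>poly_growth_part K.
        (\<exists>\<eta>. 0 < \<eta> \<and> \<eta> < ?E \<and> H = H_form (g m) (D m) \<eta>) \<and> good_scales g m m\<^sub>2 q D H L"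
      using H_mem[OF rational_powr_mem[OF r(1)]] L_exists[OF r(2) E(2)[OF r(2,3)]] r(2,3) by blast
    fix \<eta> assume \<eta>: "0 < \<eta> \<and> \<eta> < ?E"
    show "\<exists>L\<in>poly_growth_part K. H_form (g m) (D m) \<eta> \<in> o[at_top](L) \<and>
        good_scales g m m\<^sub>2 q D (H_form (g m) (D m) \<eta>) L"
      using L_exists[of \<eta>] E(2)[of \<eta>] \<eta> by blast
    show "H_form (g m) (D m) \<eta> \<in> poly_growth_part K" if "(\<lambda>t. t powr \<eta>) \<in> K"
      by (rule H_mem[OF that])
    show "good_scales g m m\<^sub>2 q D (H_form (g m) (D m) \<eta>) L"
      if "L \<in> poly_growth_part K" "positive_sublinear L \<and> H_form (g m) (D m) \<eta> \<in> o[at_top](L) \<and>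
        scales_separated g m m\<^sub>2 D (H_form (g m) (D m) \<eta>) L" for L
      using good_scalesI[of \<eta> L] E(2)[of \<eta>] \<eta> that by blast
  qed
qed

end
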